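(* Let $K$ be an infinite field and $X$ a set with $|X|\ge2$; write $\mathbb{A}=\mathbb{A}_K(X)$. Then: (1) the set of non-invertible elements $P\in\mathbb{A}$ that self-generate their centralizer is $0$-definable in $\mathbb{A}$ by a formula of the language of rings independent of $K$ and $X$; (2) there is a formula $Is(x,y,u,v)$ of the language of rings such that for every such $K$, $X$ and all non-invertible $P,Q\in\mathbb{A}$ that self-generate their centralizers, $Is(x,y,P,Q)$ defines in $\mathbb{A}$ the graph of the ring isomorphism $C_{\mathbb{A}}(P)\to C_{\mathbb{A}}(Q)$, $\sum_{i=0}^n\alpha_iP^i\mapsto\sum_{i=0}^n\alpha_iQ^i$ ($\alpha_i\in K$); (3) the polynomial ring $K[t]$ in one variable over $K$ is $0$-interpretable in $\mathbb{A}$ via all proper centralizers of $\mathbb{A}$ (the proper centralizers being identified with each other through the definable isomorphisms of (2)).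
   Context: $\mathbb{A}_K(X)$ denotes the free associative unitary algebra over $K$ with free basis $X$, in the language $\{+,\cdot,0,1\}$. $C_{\mathbb{A}}(P)=\{a: aP=Pa\}$ is the centralizer of $P$; a centralizer is proper if it is not all of $\mathbb{A}$. A non-invertible $P$ self-generates its centralizer if $C_{\mathbb{A}}(P)=K[P]=\{\sum\alpha_iP^i:\alpha_i\in K\}$. $0$-definable / $0$-interpretable mean definable / interpretable by first-order formulas without parameters. *)

theory Defs
  imports "HOL-Library.Poly_Mapping" "HOL-Computational_Algebra.Polynomial"
begin

section \<open>The free associative algebra\<close>

text \<open>
  \<^typ>\<open>'a \<Rightarrow>\<^sub>0 'b\<close> carries the convolution product of a monoid algebra, but the
  monoid of exponents has to be written additively.  The free monoid on \<open>'x\<close> is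
  therefore a copy of \<^typ>\<open>'x list\<close> in which \<open>+\<close> is (noncommutative)
  concatenation and \<open>0\<close> is the empty word.
\<close>

datatype 'x word = Word (letters: "'x list")

instantiation word :: (type) monoid_add
begin

definition zero_word :: "'x word" where
  "zero_word = Word []"

definition plus_word :: "'x word \<Rightarrow> 'x word \<Rightarrow> 'x word" where
  "plus_word u v = Word (letters u @ letters v)"

instance
  by standard (simp_all add: zero_word_def plus_word_def)

end

text \<open>
  The free associative unitary algebra over the field \<open>'k\<close> with free basis (indexed by)
  \<open>'x\<close>: noncommutative polynomials, i.e. finitely supported functions from words to
  coefficients.
\<close>

type_synonym ('k, 'x) free_alg = "'x word \<Rightarrow>\<^sub>0 'k"

definition scalar :: "'k::field \<Rightarrow> ('k, 'x) free_alg" where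
  "scalar c = Poly_Mapping.single 0 c"

definition invertible_elem :: "'a::monoid_mult \<Rightarrow> bool" where
  "invertible_elem P \<longleftrightarrow> (\<exists>R. P * R = 1 \<and> R * P = 1)"

definition centralizer :: "'a::times \<Rightarrow> 'a set" where
  "centralizer P = {a. a * P = P * a}"

definition proper_centralizers :: "'a::times set set" where
  "proper_centralizers = {centralizer P | P. centralizer P \<noteq> UNIV}"

definition poly_in :: "nat \<Rightarrow> (nat \<Rightarrow> 'k::field) \<Rightarrow> ('k, 'x) free_alg \<Rightarrow> ('k, 'x) free_alg" where
  "poly_in n \<alpha> P = (\<Sum>i\<le>n. scalar (\<alpha> i) * P ^ i)"

definition self_generates :: "('k::field, 'x) free_alg \<Rightarrow> bool" where
  "self_generates P \<longleftrightarrow> centralizer P = {poly_in n \<alpha> P | n \<alpha>. True}"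

definition noninv_self_generating :: "('k::field, 'x) free_alg set" where
  "noninv_self_generating = {P. \<not> invertible_elem P \<and> self_generates P}"

definition ring_iso_on :: "'a::ring_1 set \<Rightarrow> 'b::ring_1 set \<Rightarrow> ('a \<Rightarrow> 'b) \<Rightarrow> bool" where
  "ring_iso_on S T h \<longleftrightarrow> bij_betw h S T \<and> h 1 = 1 \<and>
     (\<forall>x\<in>S. \<forall>y\<in>S. h (x + y) = h x + h y \<and> h (x * y) = h x * h y)"


section \<open>First-order logic in the language of rings\<close>

datatype tm = Var nat | Zero | One | Add tm tm | Mul tm tm

datatype fm = Eq tm tm | Neg fm | Conj fm fm | Ex nat fm

abbreviation Disj :: "fm \<Rightarrow> fm \<Rightarrow> fm" where
  "Disj \<phi> \<psi> \<equiv> Neg (Conj (Neg \<phi>) (Neg \<psi>))"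

abbreviation Imp :: "fm \<Rightarrow> fm \<Rightarrow> fm" where
  "Imp \<phi> \<psi> \<equiv> Neg (Conj \<phi> (Neg \<psi>))"

abbreviation All :: "nat \<Rightarrow> fm \<Rightarrow> fm" where
  "All i \<phi> \<equiv> Neg (Ex i (Neg \<phi>))"

fun tm_vars :: "tm \<Rightarrow> nat set" where
  "tm_vars (Var i) = {i}"
| "tm_vars Zero = {}"
| "tm_vars One = {}"
| "tm_vars (Add s t) = tm_vars s \<union> tm_vars t"
| "tm_vars (Mul s t) = tm_vars s \<union> tm_vars t"

fun free_vars :: "fm \<Rightarrow> nat set" where
  "free_vars (Eq s t) = tm_vars s \<union> tm_vars t"
| "free_vars (Neg \<phi>) = free_vars \<phi>"
| "free_vars (Conj \<phi> \<psi>) = free_vars \<phi> \<union> free_vars \<psi>"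
| "free_vars (Ex i \<phi>) = free_vars \<phi> - {i}"

fun tm_val :: "(nat \<Rightarrow> 'a::{zero,one,plus,times}) \<Rightarrow> tm \<Rightarrow> 'a" where
  "tm_val e (Var i) = e i"
| "tm_val e Zero = 0"
| "tm_val e One = 1"
| "tm_val e (Add s t) = tm_val e s + tm_val e t"
| "tm_val e (Mul s t) = tm_val e s * tm_val e t"

fun sat :: "(nat \<Rightarrow> 'a::{zero,one,plus,times}) \<Rightarrow> fm \<Rightarrow> bool" where
  "sat e (Eq s t) \<longleftrightarrow> tm_val e s = tm_val e t"
| "sat e (Neg \<phi>) \<longleftrightarrow> \<not> sat e \<phi>"
| "sat e (Conj \<phi> \<psi>) \<longleftrightarrow> sat e \<phi> \<and> sat e \<psi>"
| "sat e (Ex i \<phi>) \<longleftrightarrow> (\<exists>a. sat (e(i := a)) \<phi>)"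

text \<open>
  Truth of \<open>\<phi>(a\<^sub>0, \<dots>, a\<^sub>n\<^sub>-\<^sub>1)\<close>.  It is only used when the free variables of
  \<open>\<phi>\<close> are among \<open>0, \<dots>, n - 1\<close>, so the junk value of \<open>!\<close> beyond the end of the
  list does not matter.
\<close>

definition models :: "fm \<Rightarrow> 'a::{zero,one,plus,times} list \<Rightarrow> bool" where
  "models \<phi> as \<longleftrightarrow> sat (\<lambda>i. as ! i) \<phi>"

definition defined_by :: "fm \<Rightarrow> nat \<Rightarrow> 'a::{zero,one,plus,times} list set \<Rightarrow> bool" where
  "defined_by \<phi> n S \<longleftrightarrow> free_vars \<phi> \<subseteq> {..<n} \<and> S = {as. length as = n \<and> models \<phi> as}"


section \<open>Interpretations without parameters\<close>

text \<open>
  An interpretation of one structure in the language of rings in another: elements are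
  represented by \<open>dim\<close>-tuples satisfying \<open>dom_fm\<close>, with \<open>eq_fm\<close> representing
  equality and one formula for each symbol of the language (the graph of the operation).
\<close>

record interp =
  dim :: nat
  dom_fm :: fm
  eq_fm :: fm
  zero_fm :: fm
  one_fm :: fm
  add_fm :: fm
  mul_fm :: fm

definition interp_dom :: "interp \<Rightarrow> 'a::{zero,one,plus,times} list set" where
  "interp_dom \<Gamma> = {as. length as = dim \<Gamma> \<and> models (dom_fm \<Gamma>) as}"

definition wf_interp :: "interp \<Rightarrow> bool" where
  "wf_interp \<Gamma> \<longleftrightarrow>
     free_vars (dom_fm \<Gamma>) \<subseteq> {..<dim \<Gamma>} \<and>
     free_vars (eq_fm \<Gamma>) \<subseteq> {..<2 * dim \<Gamma>} \<and>
     free_vars (zero_fm \<Gamma>) \<subseteq> {..<dim \<Gamma>} \<and>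
     free_vars (one_fm \<Gamma>) \<subseteq> {..<dim \<Gamma>} \<and>
     free_vars (add_fm \<Gamma>) \<subseteq> {..<3 * dim \<Gamma>} \<and>
     free_vars (mul_fm \<Gamma>) \<subseteq> {..<3 * dim \<Gamma>}"

text \<open>\<open>F\<close> is the coordinate map, relevant only on the domain of the interpretation.\<close>

definition interprets ::
  "interp \<Rightarrow> ('a::{zero,one,plus,times} list \<Rightarrow> 'b::{zero,one,plus,times}) \<Rightarrow> bool"
where
  "interprets \<Gamma> F \<longleftrightarrow>
     wf_interp \<Gamma> \<and>
     F ` interp_dom \<Gamma> = UNIV \<and>
     (\<forall>a\<in>interp_dom \<Gamma>. \<forall>b\<in>interp_dom \<Gamma>. models (eq_fm \<Gamma>) (a @ b) \<longleftrightarrow> F a = F b) \<and>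
     (\<forall>a\<in>interp_dom \<Gamma>. models (zero_fm \<Gamma>) a \<longleftrightarrow> F a = 0) \<and>
     (\<forall>a\<in>interp_dom \<Gamma>. models (one_fm \<Gamma>) a \<longleftrightarrow> F a = 1) \<and>
     (\<forall>a\<in>interp_dom \<Gamma>. \<forall>b\<in>interp_dom \<Gamma>. \<forall>c\<in>interp_dom \<Gamma>.
        (models (add_fm \<Gamma>) (a @ b @ c) \<longleftrightarrow> F a + F b = F c) \<and>
        (models (mul_fm \<Gamma>) (a @ b @ c) \<longleftrightarrow> F a * F b = F c))"


section \<open>The formulas\<close>

text \<open>
  A formula that does not depend on the field and the basis has to be chosen before the
  type variables \<open>'k\<close> and \<open>'x\<close> are, which HOL cannot express by an existential
  quantifier; hence the two formulas are given as closed constants, whose types mention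
  neither \<open>'k\<close> nor \<open>'x\<close>.
\<close>

text \<open>\<open>unit_fm i j\<close> says that \<open>i\<close> is invertible, \<open>scalar_fm i j\<close> that it is
  invertible or \<open>0\<close>, i.e. lies in the ground field; \<open>j \<noteq> i\<close> is an auxiliary bound variable.\<close>

definition unit_fm :: "nat \<Rightarrow> nat \<Rightarrow> fm" where
  "unit_fm i j =
     Ex j (Conj (Eq (Mul (Var i) (Var j)) One) (Eq (Mul (Var j) (Var i)) One))"

definition scalar_fm :: "nat \<Rightarrow> nat \<Rightarrow> fm" where
  "scalar_fm i j = Disj (Eq (Var i) Zero) (unit_fm i j)"

definition commute_fm :: "nat \<Rightarrow> nat \<Rightarrow> fm" where
  "commute_fm i j = Eq (Mul (Var i) (Var j)) (Mul (Var j) (Var i))"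

text \<open>\<open>P\<close> is not invertible, and every \<open>q\<close> commuting with \<open>P\<close> has the form
  \<open>a + P r\<close> with \<open>a\<close> in the ground field; the variables \<open>0, 1, 2, 3\<close> are
  \<open>P, q, a, r\<close>.\<close>

definition self_gen_fm :: fm where
  "self_gen_fm =
     Conj (Neg (unit_fm 0 4))
       (All 1 (Imp (commute_fm 1 0)
          (Ex 2 (Ex 3 (Conj (scalar_fm 2 4)
             (Eq (Var 1) (Add (Var 2) (Mul (Var 0) (Var 3)))))))))"

text \<open>\<open>x\<close> commutes with \<open>u\<close>, \<open>y\<close> commutes with \<open>v\<close>, and for every \<open>a\<close> in the
  ground field there is \<open>b\<close> in the ground field with \<open>x - b \<in> (u - a) \<A>\<close> and
  \<open>y - b \<in> (v - a) \<A>\<close>.  For \<open>x = f(u)\<close>, \<open>y = g(v)\<close> this says \<open>f(a) = b = g(a)\<close>.  The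
  variables \<open>0, \<dots>, 7\<close> are \<open>x, y, u, v, a, b, r, s\<close>.\<close>

definition Is_fm :: fm where
  "Is_fm =
     Conj (commute_fm 0 2) (Conj (commute_fm 1 3)
       (All 4 (Imp (scalar_fm 4 8)
          (Ex 5 (Conj (scalar_fm 5 8)
             (Conj
               (Ex 6 (Eq (Add (Var 0) (Mul (Var 4) (Var 6)))
                         (Add (Var 5) (Mul (Var 2) (Var 6)))))
               (Ex 7 (Eq (Add (Var 1) (Mul (Var 4) (Var 7)))
                         (Add (Var 5) (Mul (Var 3) (Var 7)))))))))))"

end

theory Submission
  imports Defs "HOL-Computational_Algebra.Polynomial_Factorial"
begin

text \<open>
  Everything rests on Bergman's theorem: the centralizer \<open>C\<close> of a nonscalar \<open>P\<close> is \<open>K[T]\<close>.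
  Comparing leading forms, \<open>C\<close> has at most one dimension in each degree, so any two of its elements
  are algebraically dependent. Let \<open>z\<close> be the word of \<open>P\<close> with the greatest periodic repetition
  \<open>zzz\<dots>\<close>; keeping only the words commuting with \<open>z\<close> then embeds \<open>C\<close> into a polynomial ring by a map
  \<open>\<phi>\<close>, and in particular \<open>C\<close> is commutative. Take \<open>T \<in> C\<close> with \<open>\<theta> = \<phi> T\<close> of least positive degree and
  let \<open>c \<in> C\<close>. With a central variable \<open>t\<close>, the elements \<open>\<theta>(t) - T\<close> and \<open>(\<phi> c)(t) - c\<close> commute, so the
  weak algorithm provides a greatest common left divisor \<open>D\<close>, which turns out to have coefficients in \<open>C\<close>.
  Having a common root, the two elements are not coprime, and minimality of \<open>T\<close> forces \<open>D\<close> to be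
  \<open>\<theta>(t) - T\<close> itself; setting \<open>t = 0\<close> shows that \<open>T - \<theta>(0)\<close> divides \<open>c\<close> up to a scalar, and induction on
  the degree gives \<open>C = K[T]\<close>. The formulas express divisibility by \<open>P\<close>, respectively the equality of
  the values of two polynomials at all points of the infinite field.
\<close>

text \<open>Commutativity of \<open>C\<close> is known only once the embedding exists. The
  dependence between two elements is therefore kept as an identity \<open>\<beta>(a) = c * b\<close>
  whose cofactor \<open>c\<close> lies in every subalgebra containing \<open>a\<close> and
  \<open>b\<close>, so that \<phi>, which is multiplicative only on a subalgebra, can be applied to
  it. An embedding into polynomials alone would still allow a ring like the one generated by the
  square and the cube of a variable. What excludes this is one-sided divisibility in the free
  algebra over \<open>K[t]\<close>. There the weak algorithm works only up to nonzero coefficients,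
  which Gauss' lemma removes; hence the generality of coefficient rings in the early lemmas. Three
  degrees occur: word length, the degree of \<phi>, and the degree in \<open>t\<close>. First-order
  formulas cannot quantify over polynomials of unbounded degree. A single division by
  \<open>P\<close> is enough because the degree of the quotient drops, and the scalars are definable
  as zero and the units.\<close>

abbreviation lookup :: "('b \<Rightarrow>\<^sub>0 'a::zero) \<Rightarrow> 'b \<Rightarrow> 'a" where
  "lookup \<equiv> Poly_Mapping.lookup"

abbreviation keys :: "('b \<Rightarrow>\<^sub>0 'a::zero) \<Rightarrow> 'b set" where
  "keys \<equiv> Poly_Mapping.keys"

abbreviation cst :: "'a::zero \<Rightarrow> 'x word \<Rightarrow>\<^sub>0 'a" where
  "cst \<equiv> Poly_Mapping.single 0"

abbreviation wlen :: "'x word \<Rightarrow> nat" where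
  "wlen w \<equiv> length (letters w)"

section \<open>Product and scalars in terms of words\<close>

lemma letters_plus [simp]: "letters (u + v) = letters u @ letters v"
  by (simp add: plus_word_def)

lemma letters_zero [simp]: "letters 0 = []"
  by (simp add: zero_word_def)

lemma wlen_eq_0_iff [simp]: "letters w = [] \<longleftrightarrow> w = 0"
  by (cases w) (simp add: zero_word_def)

text \<open>A word has exactly one factorization for each length of the prefix, so the convolution
  becomes a finite sum over cut positions.\<close>

lemma lookup_mult_word:
  fixes f g :: "'x word \<Rightarrow>\<^sub>0 'a::semiring_0"
  shows "lookup (f * g) w =
    (\<Sum>i\<le>wlen w. lookup f (Word (take i (letters w))) * lookup g (Word (drop i (letters w))))"
proof -
  obtain ls where w: "w = Word ls" by (cases w)
  define S where "S = (\<lambda>i. Word (take i ls)) ` {..length ls}"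
  have inj: "inj_on (\<lambda>i. Word (take i ls)) {..length ls}"
    by (rule inj_onI) (metis atMost_iff length_take min.absorb2 word.inject)
  have split: "(Word ls = Word (take i ls) + q) = (q = Word (drop i ls))" if "i \<le> length ls" for i q
    by (cases q) (metis append_take_drop_id letters_plus plus_word_def same_append_eq word.sel)
  have out: "(\<Sum>q. lookup g q when Word ls = l + q) = 0" if "l \<notin> S" for l
  proof -
    have "Word ls \<noteq> l + q" for q
    proof
      assume "Word ls = l + q"
      then have "ls = letters l @ letters q" by (metis letters_plus word.sel)
      then have "l = Word (take (wlen l) ls)" "wlen l \<le> length ls" by (cases l; simp)+
      with that show False unfolding S_def by blast
    qed
    then show ?thesis by simp
  qed
  have "lookup (f * g) w = (\<Sum>l\<in>S. lookup f l * (\<Sum>q. lookup g q when Word ls = l + q))"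
    unfolding lookup_mult w
  proof (rule Sum_any.expand_superset)
    show "finite S" by (simp add: S_def)
    show "{l. lookup f l * (\<Sum>q. lookup g q when Word ls = l + q) \<noteq> 0} \<subseteq> S"
      using out by (metis (mono_tags, lifting) mem_Collect_eq mult_zero_right subsetI)
  qed
  also have "\<dots> = (\<Sum>i\<le>length ls. lookup f (Word (take i ls)) *
      (\<Sum>q. lookup g q when Word ls = Word (take i ls) + q))"
    unfolding S_def by (subst sum.reindex[OF inj]) simp
  also have "\<dots> = (\<Sum>i\<le>length ls. lookup f (Word (take i ls)) * lookup g (Word (drop i ls)))"
    by (rule sum.cong) (simp_all add: split)
  finally show ?thesis by (simp add: w)
qed

lemma lookup_cst: "lookup (cst c) w = (if w = 0 then c else 0)"
  by (auto simp: lookup_single when_def)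

lemma lookup_cst_Word: "lookup (cst c) (Word ls) = (if ls = [] then c else 0)"
  using wlen_eq_0_iff[of "Word ls"] by (simp add: lookup_cst)

lemma cst_mult: "cst (a * b) = cst a * cst (b :: 'a::semiring_0)"
  by (simp add: mult_single)

lemma lookup_cst_mult [simp]: "lookup (cst c * f) w = c * lookup f w"
  for c :: "'a::semiring_0" and f :: "'x word \<Rightarrow>\<^sub>0 'a"
proof -
  have "lookup (cst c * f) w = (\<Sum>i\<le>wlen w. if i = 0 then c * lookup f w else 0)"
    unfolding lookup_mult_word by (rule sum.cong) (auto simp: lookup_cst_Word)
  then show ?thesis by simp
qed

lemma lookup_mult_cst [simp]: "lookup (f * cst c) w = lookup f w * c"
  for c :: "'a::semiring_0" and f :: "'x word \<Rightarrow>\<^sub>0 'a"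
proof -
  have "lookup (f * cst c) w = (\<Sum>i\<le>wlen w. if i = wlen w then lookup f w * c else 0)"
    unfolding lookup_mult_word by (rule sum.cong) (auto simp: lookup_cst_Word)
  then show ?thesis by simp
qed

lemma cst_commute: "cst c * f = f * cst c" for c :: "'a::comm_semiring_0" and f :: "'x word \<Rightarrow>\<^sub>0 'a"
  by (rule poly_mapping_eqI) (simp add: mult.commute)

section \<open>Degree and leading words\<close>

text \<open>Degree less than \<open>n\<close>, as a predicate: zero satisfies it for every
  \<open>n\<close>, so the cancellation of leading forms needs no case distinction.\<close>

definition dlt :: "('x word \<Rightarrow>\<^sub>0 'a::zero) \<Rightarrow> nat \<Rightarrow> bool" where
  "dlt f n \<longleftrightarrow> (\<forall>w. n \<le> wlen w \<longrightarrow> lookup f w = 0)"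

lemma dlt_0_iff [simp]: "dlt f 0 \<longleftrightarrow> f = 0"
proof
  assume "dlt f 0"
  then show "f = 0" by (intro poly_mapping_eqI) (simp add: dlt_def)
qed (simp add: dlt_def)

lemma dlt_mono: "dlt f m \<Longrightarrow> m \<le> n \<Longrightarrow> dlt f n"
  by (auto simp: dlt_def)

lemma dlt_zero [simp]: "dlt 0 n" by (simp add: dlt_def)

lemma dlt_add: "dlt f n \<Longrightarrow> dlt g n \<Longrightarrow> dlt (f + g) n" for f :: "'x word \<Rightarrow>\<^sub>0 'a::monoid_add"
  by (auto simp: dlt_def lookup_add)

lemma dlt_diff: "dlt f n \<Longrightarrow> dlt g n \<Longrightarrow> dlt (f - g) n" for f :: "'x word \<Rightarrow>\<^sub>0 'a::ab_group_add"
  by (auto simp: dlt_def lookup_minus)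

lemma dlt_cst_mult: "dlt f n \<Longrightarrow> dlt (cst c * f) n" for c :: "'a::semiring_0" and f :: "'x word \<Rightarrow>\<^sub>0 'a"
  by (auto simp: dlt_def)

lemma dlt_cst: "dlt (cst c) (Suc 0)"
  by (auto simp: dlt_def lookup_cst)

lemma dlt_1_cst: "dlt f (Suc 0) \<Longrightarrow> f = cst (lookup f 0)"
proof (rule poly_mapping_eqI)
  fix w assume d: "dlt f (Suc 0)"
  show "lookup f w = lookup (cst (lookup f 0)) w"
  proof (cases "w = 0")
    case False
    then have "letters w \<noteq> []" by simp
    then have "Suc 0 \<le> wlen w" by (cases "letters w") simp_all
    with d False show ?thesis by (simp add: dlt_def lookup_cst)
  qed (simp add: lookup_cst)
qed

lemma ex_dlt: "\<exists>n. dlt f n"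
proof (intro exI)
  show "dlt f (Suc (Max (insert 0 (wlen ` keys f))))"
    unfolding dlt_def
  proof (intro allI impI, rule ccontr)
    fix w assume "Suc (Max (insert 0 (wlen ` keys f))) \<le> wlen w" "lookup f w \<noteq> 0"
    moreover from this have "wlen w \<le> Max (insert 0 (wlen ` keys f))"
      by (intro Max_ge) (auto simp: in_keys_iff)
    ultimately show False by simp
  qed
qed

definition wdeg :: "('x word \<Rightarrow>\<^sub>0 'a::zero) \<Rightarrow> nat" where
  "wdeg f = (LEAST n. dlt f (Suc n))"

lemma dlt_wdeg: "dlt f (Suc (wdeg f))"
  unfolding wdeg_def 
proof (rule LeastI_ex)
  obtain n where "dlt f n" using ex_dlt by blast
  then have "dlt f (Suc n)" by (rule dlt_mono) simp
  then show "\<exists>n. dlt f (Suc n)" by (rule exI)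
qed

lemma wdeg_le: "dlt f (Suc n) \<Longrightarrow> wdeg f \<le> n"
  unfolding wdeg_def by (rule Least_le)

lemma wdeg_top:
  fixes f :: "'x word \<Rightarrow>\<^sub>0 'a::zero"
  assumes "f \<noteq> 0" shows "\<exists>w. wlen w = wdeg f \<and> lookup f w \<noteq> 0"
proof (rule ccontr)
  assume a: "\<not> ?thesis"
  have d: "dlt f (wdeg f)" unfolding dlt_def
  proof (intro allI impI)
    fix w :: "'x word" assume "wdeg f \<le> wlen w"
    then consider "wlen w = wdeg f" | "Suc (wdeg f) \<le> wlen w" by linarith
    then show "lookup f w = 0"
      by cases (use a dlt_wdeg[of f] in \<open>auto simp: dlt_def\<close>)
  qed
  show False
  proof (cases "wdeg f")
    case 0 with d assms show False by simp
  next
    case (Suc m)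
    with d wdeg_le[of f m] show False by simp
  qed
qed

lemma dlt_iff_wdeg: "dlt f n \<longleftrightarrow> f = 0 \<or> wdeg f < n"
proof
  assume d: "dlt f n"
  show "f = 0 \<or> wdeg f < n"
    using d wdeg_top[of f] unfolding dlt_def by (metis not_le)
next
  assume "f = 0 \<or> wdeg f < n"
  then show "dlt f n" using dlt_mono[OF dlt_wdeg[of f], of n] by auto
qed

lemma wdeg_eqI:
  assumes "dlt f (Suc n)" "lookup f w \<noteq> 0" "wlen w = n" shows "wdeg f = n"
proof (rule antisym)
  show "wdeg f \<le> n" by (rule wdeg_le) fact
  show "n \<le> wdeg f"
  proof (rule ccontr)
    assume "\<not> ?thesis"
    then have "Suc (wdeg f) \<le> wlen w" using assms(3) by simp
    with dlt_wdeg[of f] assms(2) show False by (simp only: dlt_def) blast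
  qed
qed

lemma wdeg_cst [simp]: "wdeg (cst c) = 0"
  using wdeg_le[OF dlt_cst] by simp

lemma wdeg_0_iff: "wdeg f = 0 \<longleftrightarrow> (\<exists>c. f = cst c)"
proof
  assume "wdeg f = 0"
  then have "f = cst (lookup f 0)" using dlt_1_cst dlt_wdeg[of f] by simp
  then show "\<exists>c. f = cst c" by (rule exI)
qed auto

text \<open>The case \<open>p = 0\<close> shows that there are no zero divisors, prime \<open>p\<close> gives Gauss' lemma.\<close>

lemma top_coeff_mod:
  fixes f g :: "'x word \<Rightarrow>\<^sub>0 'a::comm_ring_1"
  assumes f: "\<And>u. n < wlen u \<Longrightarrow> p dvd lookup f u"
    and g: "\<And>v. m < wlen v \<Longrightarrow> p dvd lookup g v"
    and u: "wlen u = n" and v: "wlen v = m"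
  shows "p dvd lookup (f * g) (u + v) - lookup f u * lookup g v"
proof -
  let ?w = "letters u @ letters v"
  let ?t = "\<lambda>i. lookup f (Word (take i ?w)) * lookup g (Word (drop i ?w))"
  have uv: "Word (letters u) = u" "Word (letters v) = v" by simp_all
  have "lookup (f * g) (u + v) = (\<Sum>i\<le>n + m. ?t i)"
    unfolding lookup_mult_word by (simp add: u v)
  also have "\<dots> = ?t n + (\<Sum>i\<in>{..n + m} - {n}. ?t i)"
    by (rule sum.remove) auto
  also have "?t n = lookup f u * lookup g v" using u uv by simp
  finally have "lookup (f * g) (u + v) - lookup f u * lookup g v = (\<Sum>i\<in>{..n + m} - {n}. ?t i)"
    by simp
  also have "p dvd \<dots>"
  proof (rule dvd_sum)
    fix i assume i: "i \<in> {..n + m} - {n}"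
    show "p dvd ?t i"
    proof (cases "n < i")
      case True
      then have "p dvd lookup f (Word (take i ?w))" using i u v by (intro f) auto
      then show ?thesis by simp
    next
      case False
      then have "p dvd lookup g (Word (drop i ?w))" using i u v by (intro g) auto
      then show ?thesis by simp
    qed
  qed
  finally show ?thesis .
qed

lemma top_coeff:
  fixes f g :: "'x word \<Rightarrow>\<^sub>0 'a::comm_ring_1"
  assumes "dlt f (Suc (wlen u))" "dlt g (Suc (wlen v))"
  shows "lookup (f * g) (u + v) = lookup f u * lookup g v"
proof -
  have "0 dvd lookup (f * g) (u + v) - lookup f u * lookup g v"
  proof (rule top_coeff_mod)
    show "0 dvd lookup f x" if "wlen u < wlen x" for x
      using assms(1) that by (simp add: dlt_def Suc_le_eq)
    show "0 dvd lookup g x" if "wlen v < wlen x" for x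
      using assms(2) that by (simp add: dlt_def Suc_le_eq)
  qed auto
  then show ?thesis by simp
qed

lemma dlt_mult:
  fixes f g :: "'x word \<Rightarrow>\<^sub>0 'a::semiring_0"
  assumes f: "dlt f (Suc n)" and g: "dlt g m"
  shows "dlt (f * g) (n + m)"
  unfolding dlt_def
proof (intro allI impI)
  fix w :: "'x word" assume w: "n + m \<le> wlen w"
  show "lookup (f * g) w = 0"
    unfolding lookup_mult_word
  proof (rule sum.neutral, intro ballI)
    fix i assume i: "i \<in> {..wlen w}"
    show "lookup f (Word (take i (letters w))) * lookup g (Word (drop i (letters w))) = 0"
    proof (cases "n < i")
      case True then show ?thesis using f i w by (simp add: dlt_def)
    next
      case False then show ?thesis using g i w by (simp add: dlt_def)
    qed
  qed
qed

text \<open>A word has only one prefix of a given length, so the product of two leading forms cannot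
  cancel.\<close>

lemma top_mult:
  fixes f g :: "'x word \<Rightarrow>\<^sub>0 'a::idom"
  assumes "f \<noteq> 0" "g \<noteq> 0"
  shows "f * g \<noteq> 0" "wdeg (f * g) = wdeg f + wdeg g"
proof -
  obtain u v where u: "wlen u = wdeg f" "lookup f u \<noteq> 0" and v: "wlen v = wdeg g" "lookup g v \<noteq> 0"
    using wdeg_top assms by meson
  have "lookup (f * g) (u + v) = lookup f u * lookup g v"
    by (rule top_coeff) (use dlt_wdeg u v in auto)
  then have nz: "lookup (f * g) (u + v) \<noteq> 0" using u v by simp
  then show "f * g \<noteq> 0" by auto
  have "dlt (f * g) (wdeg f + Suc (wdeg g))" by (intro dlt_mult dlt_wdeg)
  then show "wdeg (f * g) = wdeg f + wdeg g"
    using nz by (intro wdeg_eqI) (auto simp: u v)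
qed

lemma free_alg_mult_eq_0_iff [simp]: "f * g = 0 \<longleftrightarrow> f = 0 \<or> g = 0"
  for f g :: "'x word \<Rightarrow>\<^sub>0 'a::idom"
  using top_mult(1)[of f g] by (metis mult_zero_left mult_zero_right)

lemma free_alg_mult_left_cancel:
  fixes f a b :: "'x word \<Rightarrow>\<^sub>0 'a::idom"
  assumes "f \<noteq> 0" "f * a = f * b" shows "a = b"
proof -
  have "f * (a - b) = 0" using assms(2) by (simp only: right_diff_distrib diff_self)
  then show ?thesis using assms(1) by (simp only: free_alg_mult_eq_0_iff) simp
qed

lemma wdeg_power:
  fixes f :: "'x word \<Rightarrow>\<^sub>0 'a::idom"
  assumes "f \<noteq> 0" shows "f ^ n \<noteq> 0" "wdeg (f ^ n) = n * wdeg f"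
proof (induction n)
  case 0
  have "wdeg (cst (1 :: 'a) :: 'x word \<Rightarrow>\<^sub>0 'a) = 0" by (rule wdeg_cst)
  then show "wdeg (f ^ 0) = 0 * wdeg f" by simp
  show "f ^ 0 \<noteq> 0" by simp
next
  case (Suc n)
  show "f ^ Suc n \<noteq> 0" using Suc(1) assms by simp
  show "wdeg (f ^ Suc n) = Suc n * wdeg f" using Suc assms top_mult(2)[of f "f ^ n"] by simp
qed

section \<open>The weak algorithm\<close>

text \<open>The right transduction of the free algebra: \<open>f\<close> is its constant term plus
  the sum of the products of \<open>strip x f\<close> with the letter \<open>x\<close>.\<close>

lift_definition strip :: "'x \<Rightarrow> ('x word \<Rightarrow>\<^sub>0 'a::zero) \<Rightarrow> 'x word \<Rightarrow>\<^sub>0 'a" is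
  "\<lambda>x f w. f (w + Word [x])"
proof -
  fix x :: 'x and f :: "'x word \<Rightarrow> 'a"
  assume "finite {w. f w \<noteq> 0}"
  moreover have "inj (\<lambda>w. w + Word [x])"
    by (rule injI, rule word.expand) (simp add: plus_word_def)
  ultimately have "finite ((\<lambda>w. w + Word [x]) -` {w. f w \<noteq> 0})"
    by (rule finite_vimageI)
  then show "finite {w. f (w + Word [x]) \<noteq> 0}"
    by (simp add: vimage_def)
qed

lemma lookup_strip: "lookup (strip x f) w = lookup f (w + Word [x])"
  by transfer simp

lemma strip_diff: "strip x (f - g) = strip x f - strip x g" for f :: "'x word \<Rightarrow>\<^sub>0 'a::ab_group_add"
  by (rule poly_mapping_eqI) (simp add: lookup_strip lookup_minus)

lemma dlt_strip: "dlt f (Suc n) \<Longrightarrow> dlt (strip x f) n"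
  by (auto simp: dlt_def lookup_strip)

text \<open>The last letter of a product of two words comes from the second word unless that one is
  empty; the exception is the second summand.\<close>

lemma strip_mult:
  fixes f g :: "'x word \<Rightarrow>\<^sub>0 'a::comm_ring_1"
  shows "strip x (f * g) = f * strip x g + cst (lookup g 0) * strip x f"
proof (rule poly_mapping_eqI)
  fix w :: "'x word"
  obtain ls where w: "w = Word ls" by (cases w)
  have "lookup (strip x (f * g)) w =
    (\<Sum>i\<le>Suc (length ls). lookup f (Word (take i (ls @ [x]))) * lookup g (Word (drop i (ls @ [x]))))"
    by (simp add: lookup_strip lookup_mult_word w)
  also have "\<dots> = (\<Sum>i\<le>length ls. lookup f (Word (take i (ls @ [x]))) * lookup g (Word (drop i (ls @ [x]))))
      + lookup f (Word (ls @ [x])) * lookup g 0"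
    by (simp add: zero_word_def)
  also have "(\<Sum>i\<le>length ls. lookup f (Word (take i (ls @ [x]))) * lookup g (Word (drop i (ls @ [x]))))
      = lookup (f * strip x g) w"
    unfolding lookup_mult_word
    by (rule sum.cong) (auto simp: w lookup_strip plus_word_def)
  also have "lookup (f * strip x g) w + lookup f (Word (ls @ [x])) * lookup g 0 =
     lookup (f * strip x g + cst (lookup g 0) * strip x f) w"
    by (simp add: lookup_add lookup_strip w plus_word_def mult.commute)
  finally show "lookup (strip x (f * g)) w = lookup (f * strip x g + cst (lookup g 0) * strip x f) w" .
qed

text \<open>
  By the twisted Leibniz rule above, stripping a last letter of \<open>a\<close> turns \<open>f a - g b\<close> into a relation
  of the same shape up to terms of degree less than \<open>n\<close>, so \<open>a\<close> can be reduced to a scalar.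
\<close>

lemma weak_algorithm:
  fixes f g a b :: "'x word \<Rightarrow>\<^sub>0 'a::comm_ring_1"
  assumes "dlt f (Suc n)" "dlt g (Suc n)" "wlen w = m" "lookup a w \<noteq> 0"
    "dlt a (Suc m)" "dlt (f * a - g * b) (n + m)"
  shows "\<exists>d q. d \<noteq> 0 \<and> dlt (cst d * f - g * q) n"
  using assms(3-)
proof (induction m arbitrary: a b w)
  case 0
  have a: "a = cst (lookup a 0)" using 0(3) by (rule dlt_1_cst)
  have nz: "lookup a 0 \<noteq> 0" using 0(1,2) by simp
  have "dlt (f * cst (lookup a 0) - g * b) n"
    using 0(4) by (subst a[symmetric]) simp
  then have "dlt (cst (lookup a 0) * f - g * b) n"
    by (simp add: cst_commute)
  with nz show ?case by blast
next
  case (Suc m)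
  obtain v x where w: "w = v + Word [x]" and v: "wlen v = m"
  proof (cases w)
    case (Word ls)
    then obtain us x where "ls = us @ [x]" using Suc(2) by (metis length_Suc_conv_rev word.sel)
    with Word Suc(2) show ?thesis by (intro that[of "Word us" x]) (auto simp: plus_word_def)
  qed
  have eq: "strip x (f * a - g * b) = (f * strip x a - g * strip x b) +
      (cst (lookup a 0) * strip x f - cst (lookup b 0) * strip x g)"
    by (simp add: strip_diff strip_mult)
  \<comment> \<open>The constant terms of \<open>a\<close> and \<open>b\<close> are scalars and
    \<open>f\<close>, \<open>g\<close> have degree at most \<open>n\<close>, so stripping a letter
    leaves degree less than \<open>n\<close>.\<close>
  have low: "dlt (cst (lookup a 0) * strip x f - cst (lookup b 0) * strip x g) n"
    by (intro dlt_diff dlt_cst_mult dlt_strip assms(1,2))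
  have "dlt (strip x (f * a - g * b)) (n + m)"
    by (rule dlt_strip) (use Suc in simp)
  from dlt_diff[OF this dlt_mono[OF low]] have "dlt (f * strip x a - g * strip x b) (n + m)"
    unfolding eq by simp
  then show ?case
    using Suc(3,4) w v by (intro Suc.IH[of v "strip x a"]) (auto simp: lookup_strip intro!: dlt_strip)
qed

section \<open>Greatest common left divisors up to coefficients\<close>

lemma cst_mult_assoc: "f * (cst c * g) = cst c * (f * g)"
  for c :: "'a::comm_semiring_0" and f g :: "'x word \<Rightarrow>\<^sub>0 'a"
proof -
  have "f * (cst c * g) = (f * cst c) * g" by (simp only: mult.assoc)
  also have "\<dots> = (cst c * f) * g" by (simp only: cst_commute)
  finally show ?thesis by (simp only: mult.assoc)
qed

lemma cst_swap: "cst c * (cst d * f) = cst d * (cst c * f)"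
  for c d :: "'a::comm_semiring_0" and f :: "'x word \<Rightarrow>\<^sub>0 'a"
  by (simp only: mult.assoc[symmetric] cst_mult[symmetric] mult.commute[of c d])

lemma wdeg_0 [simp]: "wdeg 0 = 0"
  using wdeg_le[of 0 0] by simp

lemma cst_eq_0_iff [simp]: "cst c = 0 \<longleftrightarrow> c = 0"
  by (metis lookup_single_eq lookup_zero single_zero)

text \<open>A greatest common left divisor over the fraction field of the coefficients, with the
  central denominators cleared.\<close>

definition pseudo_gcd :: "('x word \<Rightarrow>\<^sub>0 'a::idom) \<Rightarrow> ('x word \<Rightarrow>\<^sub>0 'a) \<Rightarrow> ('x word \<Rightarrow>\<^sub>0 'a) \<Rightarrow> bool" where
  "pseudo_gcd f g D \<longleftrightarrow> D \<noteq> 0 \<and> (\<exists>x y. D = f * x + g * y) \<and>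
    (\<exists>d f'. d \<noteq> 0 \<and> cst d * f = D * f') \<and> (\<exists>e g'. e \<noteq> 0 \<and> cst e * g = D * g')"

lemma pseudo_gcd_commute: "pseudo_gcd f g D \<longleftrightarrow> pseudo_gcd g f D"
proof -
  have "(\<exists>x y. D = f * x + g * y) \<longleftrightarrow> (\<exists>x y. D = g * x + f * y)"
    by (metis add.commute)
  then show ?thesis unfolding pseudo_gcd_def by blast
qed

text \<open>Division with remainder keeps the common left divisors over the fraction field; the
  multiplier \<open>d\<close> merely joins the denominators.\<close>

lemma pseudo_gcd_step:
  fixes f g :: "'x word \<Rightarrow>\<^sub>0 'a::idom"
  assumes h: "cst d * f = h + g * q" and d: "d \<noteq> 0" and D: "pseudo_gcd h g D"
  shows "pseudo_gcd f g D"
proof -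
  from D obtain x y h' g' e1 e2 where
    D: "D \<noteq> 0" "D = h * x + g * y" "e1 \<noteq> 0" "e2 \<noteq> 0" "cst e1 * h = D * h'" "cst e2 * g = D * g'"
    unfolding pseudo_gcd_def by blast
  have h': "h = cst d * f - g * q" using h by simp
  have 1: "D = f * (cst d * x) + g * (y - q * x)"
    unfolding D(2) h'
    by (simp add: left_diff_distrib right_diff_distrib mult.assoc cst_mult_assoc)
  have "cst (e1 * e2 * d) * f = cst e2 * (cst e1 * (cst d * f))"
    by (simp only: cst_mult mult.assoc cst_swap[of e1])
  also have "\<dots> = cst e2 * (cst e1 * h) + cst e1 * (cst e2 * g) * q"
    unfolding h by (simp only: distrib_left mult.assoc cst_swap[of e1 e2])
  also have "\<dots> = D * (cst e2 * h' + cst e1 * g' * q)"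
    unfolding D(5,6) by (simp add: distrib_left mult.assoc cst_mult_assoc)
  finally have "cst (e1 * e2 * d) * f = D * (cst e2 * h' + cst e1 * g' * q)" .
  moreover have "e1 * e2 * d \<noteq> 0" using d D by simp
  ultimately show ?thesis unfolding pseudo_gcd_def using 1 D by blast
qed

text \<open>Euclid's algorithm. A division step is possible because a common right multiple makes
  the leading forms comparable, and a common multiple of \<open>f\<close> and \<open>g\<close>
  yields one of \<open>h\<close> and \<open>g\<close>.\<close>

lemma ex_pseudo_gcd:
  fixes f g :: "'x word \<Rightarrow>\<^sub>0 'a::idom"
  assumes "f \<noteq> 0" "g \<noteq> 0" "a \<noteq> 0" "f * a = g * b"
  shows "\<exists>D. pseudo_gcd f g D"
proof -
  have "\<exists>D. pseudo_gcd f g D"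
    if "wdeg f + wdeg g = n" "wdeg g \<le> wdeg f" "f \<noteq> 0" "g \<noteq> 0" "a \<noteq> 0" "f * a = g * b"
    for n and f g a b :: "'x word \<Rightarrow>\<^sub>0 'a"
    using that
  proof (induction n arbitrary: f g a b rule: less_induct)
    case (less n)
    obtain w where w: "wlen w = wdeg a" "lookup a w \<noteq> 0" using wdeg_top[OF less(6)] by blast
    have "\<exists>d q. d \<noteq> 0 \<and> dlt (cst d * f - g * q) (wdeg f)"
    proof (rule weak_algorithm)
      show "dlt g (Suc (wdeg f))" using dlt_mono[OF dlt_wdeg[of g]] less(3) by simp
      show "dlt (f * a - g * b) (wdeg f + wdeg a)" by (simp add: less(7))
    qed (use w dlt_wdeg in auto)
    then obtain d q where d: "d \<noteq> 0" and dq: "dlt (cst d * f - g * q) (wdeg f)" by blast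
    define h where "h = cst d * f - g * q"
    have df: "cst d * f = h + g * q" by (simp add: h_def)
    have "\<exists>D. pseudo_gcd h g D" if "h \<noteq> 0"
    proof -
      have lt: "wdeg h < wdeg f" using dq that unfolding h_def dlt_iff_wdeg by simp
      have eq: "h * a = g * (cst d * b - q * a)"
        by (simp add: h_def left_diff_distrib right_diff_distrib mult.assoc less(7) cst_mult_assoc)
      show ?thesis
      proof (cases "wdeg g \<le> wdeg h")
        case True
        show ?thesis by (rule less.IH[OF _ refl True that less(5,6) eq]) (use lt less(2) in simp)
      next
        case False
        have nz: "cst d * b - q * a \<noteq> 0"
        proof
          assume "cst d * b - q * a = 0"
          then have "h * a = 0" using eq by simp
          then show False using that less(6) by simp
        qed
        have "\<exists>D. pseudo_gcd g h D"
          by (rule less.IH[OF _ refl _ less(5) that nz eq[symmetric]]) (use lt less(2) False in auto)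
        then show ?thesis using pseudo_gcd_commute by blast
      qed
    qed
    moreover have "pseudo_gcd f g g" if "h = 0"
    proof -
      have "cst d * f = g * q" using df that by simp
      moreover have "cst 1 * g = g * 1" by simp
      moreover have "g = f * 0 + g * 1" by simp
      ultimately show ?thesis unfolding pseudo_gcd_def using less(5) d one_neq_zero by blast
    qed
    ultimately show ?case using pseudo_gcd_step[OF df d] by blast
  qed
  moreover have "b \<noteq> 0" using assms by force
  ultimately show ?thesis
    using assms pseudo_gcd_commute by (metis nat_le_linear)
qed

section \<open>Gauss' lemma\<close>

definition cdvd :: "'a::comm_ring_1 \<Rightarrow> ('x word \<Rightarrow>\<^sub>0 'a) \<Rightarrow> bool" where
  "cdvd p f \<longleftrightarrow> (\<forall>w. p dvd lookup f w)"

lemma cdvd_iff: "cdvd p f \<longleftrightarrow> (\<exists>f'. f = cst p * f')" for p :: "'a::comm_ring_1"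
proof
  assume p: "cdvd p f"
  show "\<exists>f'. f = cst p * f'"
  proof (intro exI poly_mapping_eqI)
    fix w
    \<comment> \<open>\<open>Poly_Mapping.map\<close> keeps zero coefficients at zero, so the
      quotient chosen for them has no influence.\<close>
    show "lookup f w = lookup (cst p * Poly_Mapping.map (\<lambda>x. SOME k. x = p * k) f) w"
      using someI_ex[of "\<lambda>k. lookup f w = p * k"] p
      by (simp add: cdvd_def dvd_def Poly_Mapping.map.rep_eq when_def)
  qed
qed (auto simp: cdvd_def)

text \<open>Longest words whose coefficients escape \<open>p\<close>, one in each factor, give a
  coefficient of the product that is congruent modulo \<open>p\<close> to the product of the
  two.\<close>

lemma prime_cdvd_mult:
  fixes p :: "'a::idom" and f g :: "'x word \<Rightarrow>\<^sub>0 'a"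
  assumes p: "prime_elem p" and fg: "cdvd p (f * g)"
  shows "cdvd p f \<or> cdvd p g"
proof (rule ccontr)
  assume neg: "\<not> ?thesis"
  have ex: "\<exists>u. \<not> p dvd lookup h u \<and> (\<forall>v. wlen u < wlen v \<longrightarrow> p dvd lookup h v)"
    if "\<not> cdvd p h" for h :: "'x word \<Rightarrow>\<^sub>0 'a"
  proof -
    let ?S = "{u. \<not> p dvd lookup h u}"
    have "?S \<subseteq> keys h" by (auto simp: in_keys_iff)
    then have fin: "finite (wlen ` ?S)" using finite_subset finite_keys by blast
    have "?S \<noteq> {}" using that by (auto simp: cdvd_def)
    then have "Max (wlen ` ?S) \<in> wlen ` ?S" using fin by (intro Max_in) auto
    then obtain u where u: "\<not> p dvd lookup h u" "wlen u = Max (wlen ` ?S)" by auto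
    have "wlen v \<le> wlen u" if "\<not> p dvd lookup h v" for v
      unfolding u(2) using fin that by (intro Max_ge) auto
    with u(1) show ?thesis by (metis not_le)
  qed
  from neg ex[of f] ex[of g] obtain u v where
    u: "\<not> p dvd lookup f u" "\<And>x. wlen u < wlen x \<Longrightarrow> p dvd lookup f x" and
    v: "\<not> p dvd lookup g v" "\<And>x. wlen v < wlen x \<Longrightarrow> p dvd lookup g x" by blast
  have 1: "p dvd lookup (f * g) (u + v) - lookup f u * lookup g v"
    by (rule top_coeff_mod[OF u(2) v(2)]) auto
  have 2: "p dvd lookup (f * g) (u + v)" using fg by (simp add: cdvd_def)
  have "p dvd lookup f u * lookup g v"
    using dvd_diff[OF 2 1] by simp
  then show False using p u(1) v(1) by (simp add: prime_elem_dvd_mult_iff)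
qed

definition primitive :: "('x word \<Rightarrow>\<^sub>0 'k::field poly) \<Rightarrow> bool" where
  "primitive f \<longleftrightarrow> (\<forall>p. prime_elem p \<longrightarrow> \<not> cdvd p f)"

lemma field_poly_prime_divisor:
  fixes d :: "'k::field poly"
  assumes "degree d > 0"
  shows "\<exists>p. prime_elem p \<and> p dvd d"
  using assms
proof (induction "degree d" arbitrary: d rule: less_induct)
  case less
  have d0: "d \<noteq> 0" using less(2) by auto
  have du: "\<not> d dvd 1" using less(2) is_unit_iff_degree[OF d0] by simp
  show ?case
  proof (cases "irreducible d")
    case True
    then show ?thesis by (intro exI[of _ d] conjI field_poly_irreducible_imp_prime dvd_refl)
  next
    case False
    then obtain a b where ab: "d = a * b" "\<not> a dvd 1" "\<not> b dvd 1"
      using irreducibleI[OF d0 du] by blast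
    then have "a \<noteq> 0" "b \<noteq> 0" using d0 by auto
    then have "degree a > 0" "degree b > 0"
      using ab(2,3) is_unit_iff_degree[of a] is_unit_iff_degree[of b] by simp_all
    then have "degree a < degree d" using ab \<open>a \<noteq> 0\<close> \<open>b \<noteq> 0\<close> by (simp add: degree_mult_eq)
    from less(1)[OF this \<open>degree a > 0\<close>] ab show ?thesis by (auto intro: dvd_mult2)
  qed
qed

text \<open>Brings left divisibility by \<open>D\<close> from rational functions down to
  \<open>K[t]\<close>: a prime factor of \<open>d\<close> divides \<open>D * e\<close>, hence
  \<open>e\<close>, and can be cancelled.\<close>

lemma gauss_cancel:
  fixes D :: "'x word \<Rightarrow>\<^sub>0 'k::field poly"
  assumes D: "primitive D" and "d \<noteq> 0" "cst d * f = D * e"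
  shows "\<exists>e'. f = D * e'"
  using assms(2-)
proof (induction "degree d" arbitrary: d e rule: less_induct)
  case less
  show ?case
  proof (cases "degree d > 0")
    case False
    then have "d dvd 1" using is_unit_iff_degree[OF less(2)] by simp
    then obtain d' where "1 = d * d'" by (rule dvdE)
    then have d': "d' * d = 1" by (simp only: mult.commute)
    have "f = cst d' * (cst d * f)"
      by (simp only: mult.assoc[symmetric] cst_mult[symmetric] d') simp
    also have "\<dots> = D * (cst d' * e)" by (simp add: less(3) cst_mult_assoc)
    finally show ?thesis by blast
  next
    case True
    then obtain p where p: "prime_elem p" "p dvd d" using field_poly_prime_divisor by blast
    then obtain d' where d': "d = p * d'" by blast
    have nz: "p \<noteq> 0" "d' \<noteq> 0" using d' less(2) by auto
    have "\<not> p dvd 1" using p prime_elem_not_unit by blast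
    then have "degree p > 0" using is_unit_iff_degree[OF nz(1)] by simp
    then have lt: "degree d' < degree d" using d' nz by (simp add: degree_mult_eq)
    have "cdvd p (D * e)"
      unfolding less(3)[symmetric] using p by (simp add: cdvd_def)
    then have "cdvd p e" using prime_cdvd_mult[OF p(1)] D p(1) by (auto simp: primitive_def)
    then obtain e' where e': "e = cst p * e'" by (auto simp: cdvd_iff)
    have "cst p * (cst d' * f) = cst d * f" by (simp only: d' cst_mult mult.assoc)
    also have "\<dots> = D * (cst p * e')" by (simp only: less(3) e')
    also have "\<dots> = cst p * (D * e')" by (rule cst_mult_assoc)
    finally have "cst p * (cst d' * f) = cst p * (D * e')" .
    then have "cst d' * f = D * e'"
      by (rule free_alg_mult_left_cancel[rotated]) (simp add: nz)
    from less(1)[OF lt nz(2) this] show ?thesis .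
  qed
qed

text \<open>Each extracted prime lowers the degree of the coefficient of one fixed word
  \<open>w\<close>, so the extraction ends.\<close>

lemma primitive_decomp:
  fixes D :: "'x word \<Rightarrow>\<^sub>0 'k::field poly"
  assumes "D \<noteq> 0"
  shows "\<exists>h D'. h \<noteq> 0 \<and> D = cst h * D' \<and> primitive D'"
proof -
  obtain w where "lookup D w \<noteq> 0" using wdeg_top[OF assms] by blast
  then show ?thesis
  proof (induction "degree (lookup D w)" arbitrary: D rule: less_induct)
    case less
    show ?case
    proof (cases "primitive D")
      case True
      have "D = cst 1 * D" by simp
      with True show ?thesis using one_neq_zero by blast
    next
      case False
      then obtain p E where p: "prime_elem p" "D = cst p * E"
        by (auto simp: primitive_def cdvd_iff)
      have nz: "p \<noteq> 0" "lookup E w \<noteq> 0" using less(2) p by auto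
      have "\<not> p dvd 1" using p prime_elem_not_unit by blast
      then have "degree p > 0" using is_unit_iff_degree[OF nz(1)] by simp
      then have "degree (lookup E w) < degree (lookup D w)"
        using nz by (simp add: p degree_mult_eq)
      from less(1)[OF this nz(2)] obtain h D' where
        h: "h \<noteq> 0" "E = cst h * D'" "primitive D'" by blast
      have "D = cst (p * h) * D'" by (simp add: p h cst_mult mult.assoc)
      moreover have "p * h \<noteq> 0" using h nz by simp
      ultimately show ?thesis using h(3) by blast
    qed
  qed
qed

section \<open>Centralizers\<close>

lemma centralizer_iff: "a \<in> centralizer P \<longleftrightarrow> a * P = P * a"
  by (simp add: centralizer_def)

lemma centralizer_cst: "cst c \<in> centralizer P" for c :: "'a::comm_semiring_0" and P :: "'x word \<Rightarrow>\<^sub>0 'a"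
  by (simp add: centralizer_def cst_commute)

lemma centralizer_self: "P \<in> centralizer P"
  by (simp add: centralizer_def)

lemma centralizer_add: "a \<in> centralizer P \<Longrightarrow> b \<in> centralizer P \<Longrightarrow> a + b \<in> centralizer P"
  for P :: "'a::semiring_0"
  by (simp add: centralizer_def algebra_simps)

lemma centralizer_diff: "a \<in> centralizer P \<Longrightarrow> b \<in> centralizer P \<Longrightarrow> a - b \<in> centralizer P"
  for P :: "'a::ring"
  by (simp add: centralizer_def algebra_simps)

lemma centralizer_mult: "a \<in> centralizer P \<Longrightarrow> b \<in> centralizer P \<Longrightarrow> a * b \<in> centralizer P"
  for P :: "'a::semiring_0"
  unfolding centralizer_iff
proof -
  assume a: "a * P = P * a" and b: "b * P = P * b"
  have "a * b * P = a * (P * b)" by (simp only: mult.assoc b)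
  also have "\<dots> = P * (a * b)" by (simp only: mult.assoc[symmetric] a)
  finally show "a * b * P = P * (a * b)" .
qed

lemma centralizer_power: "a \<in> centralizer P \<Longrightarrow> a ^ n \<in> centralizer P"
  for P :: "'a::semiring_1"
  by (induction n) (auto simp: centralizer_mult, simp add: centralizer_def)

lemma centralizer_sum: "(\<And>i. i \<in> I \<Longrightarrow> f i \<in> centralizer P) \<Longrightarrow> sum f I \<in> centralizer P"
  for P :: "'a::semiring_0"
  by (induction I rule: infinite_finite_induct) (auto simp: centralizer_add, auto simp: centralizer_def)

section \<open>Leading forms and algebraic dependence in a centralizer\<close>

text \<open>Commutation is itself the relation required by the weak algorithm; the outcome is that
  the leading form of \<open>f\<close> is a left factor of that of \<open>p\<close>.\<close>

lemma centralizer_degree_step: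
  fixes P f p :: "('k::field, 'x) free_alg"
  assumes f: "f \<noteq> 0" "f * p = p * f" and p: "p \<noteq> 0" and le: "wdeg f \<le> wdeg p"
  shows "\<exists>d q. d \<noteq> 0 \<and> dlt (cst d * p - f * q) (wdeg p)"
proof -
  obtain w where w: "wlen w = wdeg f" "lookup f w \<noteq> 0" using wdeg_top[OF f(1)] by blast
  show ?thesis
  proof (rule weak_algorithm)
    show "dlt f (Suc (wdeg p))" using dlt_mono[OF dlt_wdeg[of f]] le by simp
    show "dlt (p * f - f * p) (wdeg p + wdeg f)" by (simp add: f)
  qed (use w dlt_wdeg in auto)
qed

text \<open>The leading forms of \<open>f\<close> and \<open>g\<close> are left factors of the
  leading form of one power of \<open>P\<close>, and left factors of the same degree are
  proportional.\<close>

lemma centralizer_proportional: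
  fixes P f g :: "('k::field, 'x) free_alg"
  assumes P: "wdeg P > 0" and fC: "f \<in> centralizer P" and gC: "g \<in> centralizer P"
    and nz: "f \<noteq> 0" "g \<noteq> 0" and deg: "wdeg f = n" "wdeg g = n"
  shows "\<exists>c. dlt (f - cst c * g) n"
proof -
  \<comment> \<open>A power of \<open>P\<close> commutes with \<open>f\<close> and \<open>g\<close>;
    the exponent \<open>n\<close> makes its degree at least \<open>n\<close>.\<close>
  define p where "p = P ^ n"
  have P0: "P \<noteq> 0" using P by auto
  have p: "p \<noteq> 0" "wdeg p = n * wdeg P" using wdeg_power[OF P0] by (auto simp: p_def)
  have le: "n \<le> wdeg p" using P p by simp
  have comm: "h * p = p * h" if "h \<in> centralizer P" for h
    using that unfolding p_def centralizer_iff by (metis power_commuting_commutes)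
  obtain d q where d: "d \<noteq> 0" and q: "dlt (cst d * p - f * q) (wdeg p)"
    using centralizer_degree_step[of f p] comm nz p le deg fC by metis
  obtain e r where e: "e \<noteq> 0" and r: "dlt (cst e * p - g * r) (wdeg p)"
    using centralizer_degree_step[of g p] comm nz p le deg gC by metis
  have q0: "q \<noteq> 0"
  proof
    assume "q = 0"
    then have "dlt (cst d * p) (wdeg p)" using q by simp
    then show False using d p(1) top_mult(2)[of "cst d" p] by (simp add: dlt_iff_wdeg)
  qed
  have "dlt (f * q) (Suc (wdeg p))"
  proof -
    have "dlt (cst d * p) (Suc (wdeg p))" by (intro dlt_cst_mult dlt_wdeg)
    from dlt_diff[OF this dlt_mono[OF q]] show ?thesis by simp
  qed
  then have "n + wdeg q \<le> wdeg p" using top_mult[OF nz(1) q0] by (simp add: dlt_iff_wdeg deg)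
  moreover have "wdeg p \<le> n + wdeg q"
  proof (rule ccontr)
    assume "\<not> ?thesis"
    then have "dlt (f * q) (wdeg p)" using top_mult[OF nz(1) q0] by (simp add: dlt_iff_wdeg deg)
    from dlt_add[OF q this] have "dlt (cst d * p) (wdeg p)" by simp
    then show False using d p(1) top_mult(2)[of "cst d" p] by (simp add: dlt_iff_wdeg)
  qed
  ultimately have wq: "wdeg p = n + wdeg q" by simp
  obtain w where w: "wlen w = wdeg q" "lookup q w \<noteq> 0" using wdeg_top[OF q0] by blast
  \<comment> \<open>Both \<open>f * q\<close> and \<open>g * r\<close> agree with \<open>p\<close>
    in the leading form up to scalars; eliminating \<open>p\<close> prepares a second use of the
    weak algorithm.\<close>
  have "cst e * f * q - cst d * g * r =
      cst d * (cst e * p - g * r) - cst e * (cst d * p - f * q)"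
    by (simp add: right_diff_distrib mult.assoc cst_swap[of d e])
  also have "dlt \<dots> (n + wdeg q)"
    using q r unfolding wq by (intro dlt_diff[OF dlt_cst_mult dlt_cst_mult])
  finally have low: "dlt (cst e * f * q - cst d * g * r) (n + wdeg q)" .
  have "\<exists>a s. a \<noteq> 0 \<and> dlt (cst a * (cst e * f) - (cst d * g) * s) n"
    by (rule weak_algorithm[OF _ _ w dlt_wdeg low])
      (use deg dlt_wdeg[of f] dlt_wdeg[of g] in \<open>auto intro: dlt_cst_mult\<close>)
  then obtain a s where a: "a \<noteq> 0" and s: "dlt (cst a * (cst e * f) - (cst d * g) * s) n" by blast
  have "dlt (cst a * (cst e * f)) (Suc n)"
    using dlt_wdeg[of f] deg by (auto intro: dlt_cst_mult)
  from dlt_diff[OF this dlt_mono[OF s]] have ds: "dlt ((cst d * g) * s) (Suc n)" by simp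
  have "\<exists>c. s = cst c"
  proof (cases "s = 0")
    case True then show ?thesis by (metis single_zero)
  next
    case False
    with nz d have "wdeg ((cst d * g) * s) = n + wdeg s" by (simp add: top_mult deg)
    then have "wdeg s = 0" using ds False nz d by (simp add: dlt_iff_wdeg)
    then show ?thesis by (simp add: wdeg_0_iff)
  qed
  then obtain c where c: "s = cst c" by blast
  have "f - cst (inverse (a * e) * d * c) * g =
     cst (inverse (a * e)) * (cst a * (cst e * f) - (cst d * g) * s)"
    by (rule poly_mapping_eqI) (use a e in \<open>simp add: c lookup_minus field_simps\<close>)
  then show ?thesis using dlt_cst_mult[OF s] by metis
qed

text \<open>Gaussian elimination along the degree: one pivot of top degree pushes all other elements
  down.\<close>

lemma linear_dependence:
  fixes v :: "'i \<Rightarrow> ('k::field, 'x) free_alg"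
  assumes P: "wdeg P > 0" and "finite I" "n < card I"
    and "\<And>i. i \<in> I \<Longrightarrow> v i \<in> centralizer P" "\<And>i. i \<in> I \<Longrightarrow> dlt (v i) n"
  shows "\<exists>\<alpha>. (\<exists>i\<in>I. \<alpha> i \<noteq> 0) \<and> (\<Sum>i\<in>I. cst (\<alpha> i) * v i) = 0"
  using assms(2-)
proof (induction n arbitrary: I v)
  case 0
  then obtain i where "i \<in> I" by fastforce
  with 0 show ?case by (intro exI[of _ "\<lambda>_. 1"]) auto
next
  case (Suc n)
  show ?case
  proof (cases "\<forall>i\<in>I. dlt (v i) n")
    case True
    then show ?thesis using Suc by (intro Suc.IH) auto
  next
    case False
    then obtain k where k: "k \<in> I" "\<not> dlt (v k) n" by blast
    then have vk: "v k \<noteq> 0" "wdeg (v k) = n" using Suc.prems(4)[of k] by (auto simp: dlt_iff_wdeg)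
    have "\<exists>c. dlt (v i - cst c * v k) n" if "i \<in> I" for i
    proof (cases "dlt (v i) n")
      case True then show ?thesis by (intro exI[of _ 0]) simp
    next
      case False
      then have "v i \<noteq> 0" "wdeg (v i) = n" using Suc.prems(4)[OF that] by (auto simp: dlt_iff_wdeg)
      then show ?thesis using centralizer_proportional[OF P] Suc.prems(3) that k vk by blast
    qed
    then obtain c where c: "\<And>i. i \<in> I \<Longrightarrow> dlt (v i - cst (c i) * v k) n" by metis
    let ?J = "I - {k}"
    have "\<exists>\<alpha>. (\<exists>i\<in>?J. \<alpha> i \<noteq> 0) \<and> (\<Sum>i\<in>?J. cst (\<alpha> i) * (v i - cst (c i) * v k)) = 0"
      using Suc.prems k c
      by (intro Suc.IH) (auto intro!: centralizer_diff centralizer_mult centralizer_cst)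
    then obtain \<alpha> where \<alpha>: "\<exists>i\<in>?J. \<alpha> i \<noteq> 0" "(\<Sum>i\<in>?J. cst (\<alpha> i) * (v i - cst (c i) * v k)) = 0" by blast
    \<comment> \<open>The coefficient of the pivot collects what the elimination subtracted.\<close>
    define \<beta> where "\<beta> = \<alpha>(k := - (\<Sum>i\<in>?J. \<alpha> i * c i))"
    have "(\<Sum>i\<in>I. cst (\<beta> i) * v i) = cst (\<beta> k) * v k + (\<Sum>i\<in>?J. cst (\<alpha> i) * v i)"
      using Suc.prems k by (simp add: sum.remove[of I k] \<beta>_def)
    also have "cst (\<beta> k) * v k = - (\<Sum>i\<in>?J. cst (\<alpha> i * c i) * v k)"
      by (rule poly_mapping_eqI) (simp add: \<beta>_def lookup_sum sum_distrib_right)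
    also have "- (\<Sum>i\<in>?J. cst (\<alpha> i * c i) * v k) + (\<Sum>i\<in>?J. cst (\<alpha> i) * v i) =
       (\<Sum>i\<in>?J. cst (\<alpha> i) * (v i - cst (c i) * v k))"
      by (simp add: right_diff_distrib sum_subtractf cst_mult mult.assoc)
    finally have "(\<Sum>i\<in>I. cst (\<beta> i) * v i) = 0" using \<alpha> by simp
    moreover have "\<exists>i\<in>I. \<beta> i \<noteq> 0" using \<alpha> by (auto simp: \<beta>_def)
    ultimately show ?thesis by blast
  qed
qed

text \<open>Serves to say that a cofactor is generated by \<open>a\<close> and \<open>b\<close>,
  without fixing the subalgebra in advance.\<close>

definition subalg :: "('x word \<Rightarrow>\<^sub>0 'a::semiring_0) set \<Rightarrow> bool" where
  "subalg S \<longleftrightarrow> (\<forall>k. cst k \<in> S) \<and> (\<forall>x\<in>S. \<forall>y\<in>S. x + y \<in> S \<and> x * y \<in> S)"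

lemma subalg_cst: "subalg S \<Longrightarrow> cst k \<in> S"
  and subalg_add: "subalg S \<Longrightarrow> x \<in> S \<Longrightarrow> y \<in> S \<Longrightarrow> x + y \<in> S"
  and subalg_mult: "subalg S \<Longrightarrow> x \<in> S \<Longrightarrow> y \<in> S \<Longrightarrow> x * y \<in> S"
  by (auto simp: subalg_def)

lemma subalg_sum: "subalg S \<Longrightarrow> (\<And>i. i \<in> I \<Longrightarrow> f i \<in> S) \<Longrightarrow> sum f I \<in> S"
  by (induction I rule: infinite_finite_induct)
    (auto simp: subalg_add, use subalg_cst[of S 0] in auto)

lemma subalg_power: "subalg S \<Longrightarrow> x \<in> S \<Longrightarrow> x ^ n \<in> S"
  for x :: "'x word \<Rightarrow>\<^sub>0 'a::semiring_1"
  by (induction n) (auto simp: subalg_mult, use subalg_cst[of S 1] in auto)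

lemma subalg_uminus: "subalg S \<Longrightarrow> x \<in> S \<Longrightarrow> - x \<in> S"
  for x :: "'x word \<Rightarrow>\<^sub>0 'a::ring_1"
  using subalg_mult[of S "cst (- 1)" x] subalg_cst[of S "- 1"] by (simp add: single_uminus)

text \<open>The powers of \<open>b\<close> stand on the right, so \<open>b\<close> splits off
  without commuting anything; if the polynomial in \<open>a\<close> belonging to
  \<open>b ^ 0\<close> vanishes, the rest is divided by \<open>b\<close> on the right.\<close>

lemma dependence_divide:
  fixes a b :: "'x word \<Rightarrow>\<^sub>0 'a::idom"
  assumes "b \<noteq> 0" "\<exists>j\<le>M. \<exists>i\<le>N. \<alpha> j i \<noteq> 0"
    and "(\<Sum>j\<le>M. (\<Sum>i\<le>N. cst (\<alpha> j i) * a ^ i) * b ^ j) = 0"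
  shows "\<exists>\<beta> c. (\<exists>i\<le>N. \<beta> i \<noteq> 0) \<and> (\<Sum>i\<le>N. cst (\<beta> i) * a ^ i) = c * b \<and>
    (\<forall>S. subalg S \<longrightarrow> a \<in> S \<longrightarrow> b \<in> S \<longrightarrow> c \<in> S)"
  using assms(2-)
proof (induction M arbitrary: \<alpha>)
  case 0
  then show ?case
    by (intro exI[of _ "\<alpha> 0"] exI[of _ 0]) (auto intro: subalg_cst[of _ 0, simplified])
next
  case (Suc M)
  define r where "r j = (\<Sum>i\<le>N. cst (\<alpha> j i) * a ^ i)" for j
  define c where "c = (\<Sum>j\<le>M. r (Suc j) * b ^ j)"
  have rS: "r j \<in> S" if "subalg S" "a \<in> S" for j S
    unfolding r_def using that by (intro subalg_sum subalg_mult subalg_power subalg_cst) auto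
  have "r 0 + c * b = (\<Sum>j\<le>Suc M. r j * b ^ j)"
    by (subst sum.atMost_Suc_shift)
      (simp add: c_def sum_distrib_right mult.assoc power_Suc2 del: power_Suc)
  then have eq: "r 0 + c * b = 0" using Suc.prems(2) by (simp add: r_def)
  show ?case
  proof (cases "\<exists>i\<le>N. \<alpha> 0 i \<noteq> 0")
    case True
    have "r 0 = (- c) * b" using eq by (simp add: add_eq_0_iff)
    moreover have "- c \<in> S" if "subalg S" "a \<in> S" "b \<in> S" for S
      unfolding c_def using that
      by (intro subalg_uminus subalg_sum subalg_mult subalg_power rS) auto
    ultimately show ?thesis using True unfolding r_def by blast
  next
    case False
    then have "r 0 = 0" by (simp add: r_def)
    with eq \<open>b \<noteq> 0\<close> have "c = 0" by simp
    moreover have "\<exists>j\<le>M. \<exists>i\<le>N. \<alpha> (Suc j) i \<noteq> 0"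
    proof -
      obtain j i where ji: "j \<le> Suc M" "i \<le> N" "\<alpha> j i \<noteq> 0" using Suc.prems by blast
      with False have "j \<noteq> 0" by metis
      with ji show ?thesis by (cases j) auto
    qed
    ultimately show ?thesis
      using Suc.IH[of "\<lambda>j. \<alpha> (Suc j)"] by (simp add: c_def r_def)
  qed
qed

lemma dlt_power: "dlt a (Suc n) \<Longrightarrow> dlt (a ^ i) (Suc (i * n))"
  for a :: "'x word \<Rightarrow>\<^sub>0 'a::comm_ring_1"
proof (induction i)
  case 0 then show ?case using dlt_cst[of "1 :: 'a"] by simp
next
  case (Suc i)
  from dlt_mult[OF Suc.prems Suc.IH[OF Suc.prems]] show ?case by (simp add: add.commute)
qed

text \<open>To be used with a \<open>b\<close> that \<phi> kills and an \<open>a\<close> whose image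
  is nonconstant, where such an identity is impossible.\<close>

lemma algebraic_dependence:
  fixes a b P :: "('k::field, 'x) free_alg"
  assumes P: "wdeg P > 0" and ab: "a \<in> centralizer P" "b \<in> centralizer P" and "b \<noteq> 0"
  shows "\<exists>N \<beta> c. (\<exists>i\<le>N. \<beta> i \<noteq> 0) \<and> (\<Sum>i\<le>N. cst (\<beta> i) * a ^ i) = c * b \<and>
    (\<forall>S. subalg S \<longrightarrow> a \<in> S \<longrightarrow> b \<in> S \<longrightarrow> c \<in> S)"
proof -
  define D where "D = wdeg a + wdeg b"
  \<comment> \<open>With this choice the \<open>(N + 1)^2\<close> products
    \<open>a ^ i * b ^ j\<close>, of degree at most \<open>N * D\<close>, outnumber the
    \<open>N * D + 1\<close> possible degrees.\<close>
  define N where "N = Suc D"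
  let ?I = "{..N} \<times> {..N}"
  define v where "v = (\<lambda>(j, i). a ^ i * b ^ j)"
  have "\<exists>\<alpha>. (\<exists>k\<in>?I. \<alpha> k \<noteq> 0) \<and> (\<Sum>k\<in>?I. cst (\<alpha> k) * v k) = 0"
  proof (rule linear_dependence[OF P, of _ "Suc (N * D)"])
    show "Suc (N * D) < card ?I" by (simp add: N_def)
    fix k assume "k \<in> ?I"
    then obtain j i where k: "k = (j, i)" "j \<le> N" "i \<le> N" by auto
    show "v k \<in> centralizer P"
      using ab by (simp add: v_def k centralizer_mult centralizer_power)
    have "dlt (a ^ i * b ^ j) (i * wdeg a + Suc (j * wdeg b))"
      by (intro dlt_mult dlt_power dlt_wdeg)
    moreover have "i * wdeg a + j * wdeg b \<le> N * D"
      unfolding D_def distrib_left by (intro add_mono mult_le_mono1 k)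
    ultimately show "dlt (v k) (Suc (N * D))"
      unfolding v_def k prod.case by (elim dlt_mono) simp
  qed simp
  then obtain \<alpha> where \<alpha>: "\<exists>k\<in>?I. \<alpha> k \<noteq> 0" "(\<Sum>k\<in>?I. cst (\<alpha> k) * v k) = 0" by blast
  have "(\<Sum>j\<le>N. (\<Sum>i\<le>N. cst (\<alpha> (j, i)) * a ^ i) * b ^ j) = (\<Sum>k\<in>?I. cst (\<alpha> k) * v k)"
    unfolding sum.cartesian_product[symmetric] v_def
    by (subst sum.cartesian_product')
      (simp add: sum_distrib_right mult.assoc)
  then have "(\<Sum>j\<le>N. (\<Sum>i\<le>N. cst (\<alpha> (j, i)) * a ^ i) * b ^ j) = 0" using \<alpha>(2) by (rule trans)
  moreover have "\<exists>j\<le>N. \<exists>i\<le>N. \<alpha> (j, i) \<noteq> 0" using \<alpha>(1) by blast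
  ultimately show ?thesis
    using dependence_divide[OF \<open>b \<noteq> 0\<close>, of N N "\<lambda>j i. \<alpha> (j, i)" a] by blast
qed

section \<open>Comparison of periodic words\<close>

text \<open>All later comparisons concern words of equal length, where \<open>lenlex\<close> is
  lexicographic; \<open>lt_prefix\<close> says that the first difference decides.\<close>

locale word_order =
  fixes lt :: "'x word \<Rightarrow> 'x word \<Rightarrow> bool"
  assumes lt_irrefl: "\<not> lt u u"
    and lt_trans: "lt u v \<Longrightarrow> lt v w \<Longrightarrow> lt u w"
    and lt_total: "u \<noteq> v \<Longrightarrow> lt u v \<or> lt v u"
    and lt_prefix: "lt u v \<Longrightarrow> wlen a = wlen b \<Longrightarrow> lt (u + a) (v + b)"
    and lt_left: "lt u v \<Longrightarrow> lt (a + u) (a + v)"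

lemma ex_word_order: "\<exists>lt :: 'x word \<Rightarrow> 'x word \<Rightarrow> bool. word_order lt"
proof -
  obtain r :: "'x rel" where "well_order_on UNIV r" using well_order_on by blast
  then have r: "trans r" "antisym r" "total r"
    by (auto simp: well_order_on_def linear_order_on_def partial_order_on_def preorder_on_def)
  define R where "R = r - Id"
  have R: "trans R" "irrefl R" "total R"
    using trans_diff_Id[OF r(1,2)] r(3) by (auto simp: R_def irrefl_def total_on_def)
  have "word_order (\<lambda>u v. (letters u, letters v) \<in> lenlex R)"
  proof
    fix u v w a b :: "'x word"
    show "(letters u, letters u) \<notin> lenlex R"
      by (rule lenlex_irreflexive) (simp add: R_def)
    show "(letters u, letters v) \<in> lenlex R \<Longrightarrow> (letters v, letters w) \<in> lenlex R \<Longrightarrow>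
        (letters u, letters w) \<in> lenlex R"
      by (rule lenlex_trans[OF _ _ R(1)])
    show "(letters u, letters v) \<in> lenlex R \<or> (letters v, letters u) \<in> lenlex R" if "u \<noteq> v"
    proof -
      have "letters u \<noteq> letters v" using that word.expand by blast
      then show ?thesis using total_lenlex[OF R(3)] by (auto simp: total_on_def)
    qed
    show "(letters u, letters v) \<in> lenlex R \<Longrightarrow> wlen a = wlen b \<Longrightarrow>
        (letters (u + a), letters (v + b)) \<in> lenlex R"
      by (simp add: lenlex_append1)
    show "(letters u, letters v) \<in> lenlex R \<Longrightarrow> (letters (a + u), letters (a + v)) \<in> lenlex R"
      by (simp add: R)
  qed
  then show ?thesis by blast
qed

lemma word_add_left_cancel [simp]: "u + v = u + w \<longleftrightarrow> v = w" for u v w :: "'x word"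
  by (auto simp: plus_word_def intro: word.expand)

lemma word_add_right_cancel [simp]: "v + u = w + u \<longleftrightarrow> v = w" for u v w :: "'x word"
  by (auto simp: plus_word_def intro: word.expand)

primrec wpow :: "'x word \<Rightarrow> nat \<Rightarrow> 'x word" where
  "wpow w 0 = 0"
| "wpow w (Suc n) = w + wpow w n"

lemma wlen_wpow [simp]: "wlen (wpow w n) = n * wlen w"
  by (induction n) auto

lemma wlen_eq_commute_imp_eq:
  fixes w z :: "'x word"
  assumes "w + z = z + w" "wlen w = wlen z" shows "w = z"
proof -
  have "letters w @ letters z = letters z @ letters w"
    using arg_cong[OF assms(1), of letters] by simp
  then have "letters w = letters z" using assms(2) append_eq_append_conv by blast
  then show ?thesis by (rule word.expand)
qed

context word_order
begin

definition le :: "'x word \<Rightarrow> 'x word \<Rightarrow> bool" where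
  "le u v \<longleftrightarrow> u = v \<or> lt u v"

lemma le_trans: "le u v \<Longrightarrow> le v w \<Longrightarrow> le u w"
  using lt_trans[of u v w] by (auto simp: le_def)

lemma le_antisym: "le u v \<Longrightarrow> le v u \<Longrightarrow> u = v"
  using lt_trans[of u v u] lt_irrefl[of u] by (auto simp: le_def)

lemma le_left: "le u v \<Longrightarrow> le (a + u) (a + v)"
  using lt_left by (auto simp: le_def)

lemma le_right: "le u v \<Longrightarrow> le (u + a) (v + a)"
  using lt_prefix by (auto simp: le_def)

lemma not_le_iff: "\<not> le u v \<longleftrightarrow> lt v u"
  using lt_total[of u v] lt_trans[of u v u] lt_irrefl[of u] by (auto simp: le_def)

text \<open>\<open>sub w z\<close> compares the infinite periodic words with periods \<open>w\<close> and \<open>z\<close> lexicographically.\<close>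

definition sub :: "'x word \<Rightarrow> 'x word \<Rightarrow> bool" where
  "sub w z \<longleftrightarrow> le (w + z) (z + w)"

lemma sub_0 [simp]: "sub 0 z" "sub z 0"
  by (simp_all add: sub_def le_def)

lemma sub_total: "sub w z \<or> sub z w"
  unfolding sub_def using not_le_iff by (auto simp: le_def)

lemma sub_add:
  assumes "sub u z" "sub v z" shows "sub (u + v) z"
proof -
  have "le (u + (v + z)) (u + (z + v))" using assms(2) unfolding sub_def by (rule le_left)
  moreover have "le ((u + z) + v) ((z + u) + v)" using assms(1) unfolding sub_def by (rule le_right)
  ultimately show ?thesis unfolding sub_def using le_trans by (simp add: add.assoc)
qed

text \<open>In the chain \<open>u + v + z\<close>, \<open>u + z + v\<close>,
  \<open>z + u + v\<close>, equality of the ends forces equality in both steps. This is what makes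
  \<phi> multiplicative.\<close>

lemma sub_add_commute:
  assumes "sub u z" "sub v z"
  shows "(u + v) + z = z + (u + v) \<longleftrightarrow> u + z = z + u \<and> v + z = z + v"
proof
  assume eq: "(u + v) + z = z + (u + v)"
  have 1: "le (u + (v + z)) (u + (z + v))" using assms(2) unfolding sub_def by (rule le_left)
  have 2: "le ((u + z) + v) ((z + u) + v)" using assms(1) unfolding sub_def by (rule le_right)
  from 2 eq have "le (u + (z + v)) (u + (v + z))" by (simp add: add.assoc)
  from le_antisym[OF 1 this] have v: "v + z = z + v" by simp
  have "(u + z) + v = u + (v + z)" by (simp add: v add.assoc)
  also have "\<dots> = (z + u) + v" using eq by (simp add: add.assoc)
  finally have "u + z = z + u" by simp
  with v show "u + z = z + u \<and> v + z = z + v" by simp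
next
  assume *: "u + z = z + u \<and> v + z = z + v"
  have "(u + v) + z = u + (v + z)" by (rule add.assoc)
  also have "\<dots> = u + (z + v)" using * by simp
  also have "\<dots> = (u + z) + v" by (rule add.assoc[symmetric])
  also have "\<dots> = (z + u) + v" using * by simp
  also have "\<dots> = z + (u + v)" by (rule add.assoc)
  finally show "(u + v) + z = z + (u + v)" .
qed

lemma sub_add_right:
  assumes "sub z u" "sub z v" shows "sub z (u + v)"
proof -
  have "le ((z + u) + v) ((u + z) + v)" using assms(1) unfolding sub_def by (rule le_right)
  moreover have "le (u + (z + v)) (u + (v + z))" using assms(2) unfolding sub_def by (rule le_left)
  ultimately show ?thesis unfolding sub_def using le_trans by (simp add: add.assoc)
qed

lemma not_sub_add:
  assumes "\<not> sub u z" "\<not> sub v z" shows "\<not> sub (u + v) z"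
proof -
  have "lt (u + (z + v)) (u + (v + z))"
    using assms(2) unfolding sub_def not_le_iff by (rule lt_left)
  moreover have "lt ((z + u) + v) ((u + z) + v)"
    using assms(1) unfolding sub_def not_le_iff by (rule lt_prefix) simp
  ultimately show ?thesis unfolding sub_def not_le_iff using lt_trans by (simp add: add.assoc)
qed

lemma not_sub_add_right:
  assumes "\<not> sub z u" "\<not> sub z v" shows "\<not> sub z (u + v)"
proof -
  have "lt (u + (v + z)) (u + (z + v))"
    using assms(2) unfolding sub_def not_le_iff by (rule lt_left)
  moreover have "lt ((u + z) + v) ((z + u) + v)"
    using assms(1) unfolding sub_def not_le_iff by (rule lt_prefix) simp
  ultimately show ?thesis unfolding sub_def not_le_iff using lt_trans by (simp add: add.assoc)
qed

text \<open>A word and its positive powers have the same infinite repetition.\<close>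

lemma sub_wpow_left: "n > 0 \<Longrightarrow> sub (wpow u n) z \<longleftrightarrow> sub u z"
proof (induction n)
  case (Suc n)
  show ?case
  proof (cases "n = 0")
    case False
    with Suc show ?thesis using sub_add[of u z "wpow u n"] not_sub_add[of u z "wpow u n"] by auto
  qed simp
qed simp

lemma sub_wpow_right: "n > 0 \<Longrightarrow> sub z (wpow u n) \<longleftrightarrow> sub z u"
proof (induction n)
  case (Suc n)
  show ?case
  proof (cases "n = 0")
    case False
    with Suc show ?thesis
      using sub_add_right[of z u "wpow u n"] not_sub_add_right[of z u "wpow u n"] by auto
  qed simp
qed simp

lemma sub_iff_le:
  assumes "wlen u = wlen v" shows "sub u v \<longleftrightarrow> le u v"
proof -
  consider "u = v" | "lt u v" | "lt v u" using lt_total by blast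
  then show ?thesis
  proof cases
    case 2
    then have "lt (u + v) (v + u)" using lt_prefix assms by metis
    with 2 show ?thesis by (simp add: sub_def le_def)
  next
    case 3
    then have "lt (v + u) (u + v)" using lt_prefix assms by metis
    with 3 show ?thesis by (simp add: sub_def not_le_iff[symmetric])
  qed (simp add: sub_def le_def)
qed

text \<open>Powers of a common length reduce the claim to transitivity of \<open>le\<close>. The
  empty word is related to every word in both directions, hence \<open>v \<noteq> 0\<close>.\<close>

lemma sub_trans:
  assumes "sub u v" "sub v w" "v \<noteq> 0" shows "sub u w"
proof (cases "u = 0 \<or> w = 0")
  case False
  let ?l = wlen
  have pos: "?l x > 0" if "x \<noteq> 0" for x :: "'x word" using that by simp
  define U V W where "U = wpow u (?l v * ?l w)" and "V = wpow v (?l u * ?l w)"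
    and "W = wpow w (?l u * ?l v)"
  have len: "?l U = ?l u * ?l v * ?l w" "?l V = ?l u * ?l v * ?l w" "?l W = ?l u * ?l v * ?l w"
    by (simp_all add: U_def V_def W_def mult.commute mult.left_commute)
  have iff: "sub (wpow x m) (wpow y n) \<longleftrightarrow> sub x y" if "m > 0" "n > 0" for x y m n
    using that by (simp add: sub_wpow_left sub_wpow_right)
  have p: "?l v * ?l w > 0" "?l u * ?l w > 0" "?l u * ?l v > 0"
    using pos False assms(3) by simp_all
  have "le U V" "le V W" using assms(1,2) iff p len sub_iff_le
    unfolding U_def V_def W_def by metis+
  then have "le U W" by (rule le_trans)
  then have "sub U W" using sub_iff_le len by simp
  then show ?thesis unfolding U_def W_def using iff p by simp
qed auto

lemma ex_sub_max:
  assumes "finite S" "S \<noteq> {}" "0 \<notin> S"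
  shows "\<exists>z\<in>S. \<forall>w\<in>S. sub w z"
  using assms
proof (induction S rule: finite_ne_induct)
  case (singleton x)
  then show ?case using sub_total[of x x] by auto
next
  case (insert x S)
  then obtain z where z: "z \<in> S" "\<forall>w\<in>S. sub w z" by auto
  show ?case
  proof (cases "sub x z")
    case True with z show ?thesis by auto
  next
    case False
    then have zx: "sub z x" using sub_total by blast
    have "z \<noteq> 0" using z insert by auto
    then have "\<forall>w\<in>insert x S. sub w x"
      using z zx sub_trans[OF _ zx] sub_total[of x x] by auto
    then show ?thesis by auto
  qed
qed

definition face :: "'x word \<Rightarrow> ('x word \<Rightarrow>\<^sub>0 'a::zero) set" where
  "face z = {f. \<forall>w\<in>keys f. sub w z}"

lemma subalg_face: "subalg (face z :: ('x word \<Rightarrow>\<^sub>0 'a::comm_ring_1) set)"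
proof -
  have "cst k \<in> face z" for k :: 'a
    by (auto simp: face_def)
  moreover have "f + g \<in> face z" if "f \<in> face z" "g \<in> face z" for f g :: "'x word \<Rightarrow>\<^sub>0 'a"
    using that keys_add[of f g] by (auto simp: face_def)
  moreover have "f * g \<in> face z" if "f \<in> face z" "g \<in> face z" for f g :: "'x word \<Rightarrow>\<^sub>0 'a"
    using that keys_mult[of f g] sub_add by (fastforce simp: face_def)
  ultimately show ?thesis by (auto simp: subalg_def)
qed

end

section \<open>Restriction to the powers of a word\<close>

text \<open>
  The words commuting with \<open>z\<close> are determined by their length, which becomes the exponent. On \<open>face z\<close>
  the map is multiplicative, because a product of two words can only commute with \<open>z\<close> if both factors do.
\<close>

definition phi :: "'x word \<Rightarrow> ('x word \<Rightarrow>\<^sub>0 'a::comm_ring_1) \<Rightarrow> 'a poly" where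
  "phi z f = (\<Sum>w\<in>keys f. if w + z = z + w then monom (lookup f w) (wlen w) else 0)"

lemma phi_superset:
  assumes "finite A" "keys f \<subseteq> A"
  shows "phi z f = (\<Sum>w\<in>A. if w + z = z + w then monom (lookup f w) (wlen w) else 0)"
  unfolding phi_def using assms
  by (intro sum.mono_neutral_left) (auto simp: in_keys_iff)

lemma phi_add: "phi z (f + g) = phi z f + phi z g"
proof -
  let ?A = "keys f \<union> keys g"
  have "phi z (f + g) = (\<Sum>w\<in>?A. if w + z = z + w then monom (lookup (f + g) w) (wlen w) else 0)"
    by (rule phi_superset) (use keys_add[of f g] in auto)
  also have "\<dots> = (\<Sum>w\<in>?A. if w + z = z + w then monom (lookup f w) (wlen w) else 0) +
     (\<Sum>w\<in>?A. if w + z = z + w then monom (lookup g w) (wlen w) else 0)"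
    by (subst sum.distrib[symmetric], rule sum.cong) (auto simp: lookup_add add_monom)
  also have "\<dots> = phi z f + phi z g"
    by (subst (1 2) phi_superset[of ?A]) auto
  finally show ?thesis .
qed

lemma phi_0 [simp]: "phi z 0 = 0"
  by (simp add: phi_def)

lemma phi_sum: "phi z (sum f I) = (\<Sum>i\<in>I. phi z (f i))"
  by (induction I rule: infinite_finite_induct) (auto simp: phi_add)

lemma phi_single:
  "phi z (Poly_Mapping.single w c) = (if w + z = z + w then monom c (wlen w) else 0)"
  by (subst phi_superset[of "{w}"]) auto

lemma phi_cst [simp]: "phi z (cst c) = [:c:]"
  by (simp add: phi_single monom_0)

lemma phi_1 [simp]: "phi z 1 = 1"
  using phi_cst[of z 1] by (simp add: one_pCons del: phi_cst)

text \<open>Among the words of its own length, only \<open>z\<close> itself commutes with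
  \<open>z\<close>. So a nonempty \<open>z\<close> in the support makes the image of
  \<open>f\<close> nonconstant.\<close>

lemma coeff_phi_wlen: "coeff (phi z f) (wlen z) = lookup f z"
proof -
  have "coeff (phi z f) (wlen z) =
    (\<Sum>w\<in>insert z (keys f). coeff (if w + z = z + w then monom (lookup f w) (wlen w) else 0) (wlen z))"
    by (subst phi_superset[of "insert z (keys f)"]) (auto simp: coeff_sum)
  also have "\<dots> = (\<Sum>w\<in>insert z (keys f). if w = z then lookup f z else 0)"
    by (rule sum.cong) (auto dest: wlen_eq_commute_imp_eq)
  also have "\<dots> = lookup f z" by (simp only: sum.delta finite_insert finite_keys) simp
  finally show ?thesis .
qed

lemma sum_single_keys: "(\<Sum>w\<in>keys f. Poly_Mapping.single w (lookup f w)) = f"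
proof (rule poly_mapping_eqI)
  fix k
  have "lookup (\<Sum>w\<in>keys f. Poly_Mapping.single w (lookup f w)) k =
     (\<Sum>w\<in>keys f. if w = k then lookup f k else 0)"
    by (auto simp: lookup_sum lookup_single when_def intro!: sum.cong)
  also have "\<dots> = lookup f k" by (simp add: in_keys_iff)
  finally show "lookup (\<Sum>w\<in>keys f. Poly_Mapping.single w (lookup f w)) k = lookup f k" .
qed

lemma (in word_order) phi_mult:
  assumes f: "f \<in> face z" and g: "g \<in> face z"
  shows "phi z (f * g) = phi z f * phi z g"
proof -
  have "f * g = (\<Sum>u\<in>keys f. \<Sum>v\<in>keys g. Poly_Mapping.single (u + v) (lookup f u * lookup g v))"
    by (subst (1 2) sum_single_keys[symmetric]) (simp add: sum_product mult_single)
  then have "phi z (f * g) =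
    (\<Sum>u\<in>keys f. \<Sum>v\<in>keys g. phi z (Poly_Mapping.single (u + v) (lookup f u * lookup g v)))"
    by (simp add: phi_sum)
  also have "\<dots> = (\<Sum>u\<in>keys f. \<Sum>v\<in>keys g.
     (if u + z = z + u then monom (lookup f u) (wlen u) else 0) *
     (if v + z = z + v then monom (lookup g v) (wlen v) else 0))"
  proof (intro sum.cong refl)
    fix u v assume "u \<in> keys f" "v \<in> keys g"
    then have "sub u z" "sub v z" using f g by (auto simp: face_def)
    from sub_add_commute[OF this] show "phi z (Poly_Mapping.single (u + v) (lookup f u * lookup g v)) =
     (if u + z = z + u then monom (lookup f u) (wlen u) else 0) *
     (if v + z = z + v then monom (lookup g v) (wlen v) else 0)"
      unfolding phi_single by (simp add: mult_monom)
  qed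
  also have "\<dots> = phi z f * phi z g" by (simp add: phi_def sum_product)
  finally show ?thesis .
qed

lemma (in word_order) phi_power:
  assumes "f \<in> face z" shows "phi z (f ^ n) = phi z f ^ n"
  by (induction n) (simp_all add: phi_mult assms subalg_power[OF subalg_face])

lemma pcompose_sum_monom: "pcompose (\<Sum>i\<le>N. monom (\<beta> i) i) r = (\<Sum>i\<le>N. [:\<beta> i:] * r ^ i)"
  for \<beta> :: "nat \<Rightarrow> 'a::comm_ring_1"
proof -
  have "pcompose (monom b i) r = [:b:] * r ^ i" for b i
    by (induction i) (simp_all add: monom_0 monom_Suc pcompose_pCons algebra_simps)
  then show ?thesis by (simp add: pcompose_sum)
qed

lemma coeff_sum_monom: "coeff (\<Sum>i\<le>N. monom (\<beta> i) i) n = (if n \<le> N then \<beta> n else 0)"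
  by (simp add: coeff_sum)

lemma degree_pos_of_coeff: "coeff p n \<noteq> 0 \<Longrightarrow> n > 0 \<Longrightarrow> degree p > 0"
  using le_degree[of p n] by simp

context word_order
begin

text \<open>Under \<phi> the identity becomes a polynomial relation for \<open>phi z a\<close>
  alone, and a nonconstant polynomial is transcendental over the coefficients.\<close>

lemma phi_dependence_trivial:
  fixes a b c :: "'x word \<Rightarrow>\<^sub>0 'a::idom"
  assumes "a \<in> face z" "b \<in> face z" "c \<in> face z" "phi z b = 0" "degree (phi z a) > 0"
    and eq: "(\<Sum>i\<le>N. cst (\<beta> i) * a ^ i) = c * b"
  shows "\<forall>i\<le>N. \<beta> i = 0"
proof -
  have "phi z (\<Sum>i\<le>N. cst (\<beta> i) * a ^ i) = (\<Sum>i\<le>N. [:\<beta> i:] * phi z a ^ i)"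
    unfolding phi_sum
    by (intro sum.cong refl)
      (simp only: phi_mult phi_power phi_cst assms(1) subalg_cst[OF subalg_face] subalg_power[OF subalg_face])
  also have "phi z (\<Sum>i\<le>N. cst (\<beta> i) * a ^ i) = 0"
    unfolding eq using assms by (simp add: phi_mult)
  finally have "pcompose (\<Sum>i\<le>N. monom (\<beta> i) i) (phi z a) = 0"
    by (simp add: pcompose_sum_monom)
  then have 0: "(\<Sum>i\<le>N. monom (\<beta> i) i) = 0" using assms(5) by (rule pcompose_eq_0)
  show ?thesis
  proof (intro allI impI)
    fix n assume "n \<le> N"
    then show "\<beta> n = 0" using coeff_sum_monom[of \<beta> N n] unfolding 0 by simp
  qed
qed

text \<open>If some \<open>f\<close> in the centralizer had a word beyond \<open>z\<close>, its
  greatest word \<open>y\<close> would lie strictly beyond all nonempty words of \<open>P\<close>.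
  Then \<open>phi y\<close> kills \<open>P\<close> without its constant term and sends
  \<open>f\<close> to a nonconstant polynomial, against their dependence.\<close>

lemma centralizer_subset_face:
  fixes P :: "('k::field, 'x) free_alg"
  assumes P: "wdeg P > 0" and z: "z \<noteq> 0" "\<forall>w\<in>keys P - {0}. sub w z"
  shows "centralizer P \<subseteq> face z"
proof
  fix f assume f: "f \<in> centralizer P"
  show "f \<in> face z"
  proof (rule ccontr)
    assume "f \<notin> face z"
    then obtain w where w: "w \<in> keys f" "\<not> sub w z" by (auto simp: face_def)
    then have "w \<noteq> 0" by auto
    with w have ne: "keys f - {0} \<noteq> {}" by auto
    obtain y where y: "y \<in> keys f - {0}" "\<forall>w\<in>keys f - {0}. sub w y"
      using ex_sub_max[OF _ ne] by auto
    have wy: "sub w y" using y w \<open>w \<noteq> 0\<close> by auto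
    \<comment> \<open>The empty word commutes with \<open>y\<close> and would survive under
      \<open>phi y\<close>.\<close>
    define P' where "P' = P - cst (lookup P 0)"
    have lP': "lookup P' w = (if w = 0 then 0 else lookup P w)" for w
      by (simp add: P'_def lookup_minus lookup_cst)
    have strict: "\<not> sub y p" if "p \<in> keys P'" for p
    proof
      assume yp: "sub y p"
      have p: "p \<noteq> 0" "p \<in> keys P" using that by (auto simp: in_keys_iff lP' split: if_splits)
      have "sub w p" using sub_trans[OF wy yp] y by auto
      then have "sub w z" using sub_trans[of w p z] p z by auto
      then show False using w by simp
    qed
    have P'y: "P' \<in> face y" using strict sub_total by (auto simp: face_def)
    have "phi y P' = 0" unfolding phi_def
    proof (rule sum.neutral, intro ballI)
      fix p assume "p \<in> keys P'"
      then have "p + y \<noteq> y + p" using strict[of p] by (auto simp: sub_def le_def)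
      then show "(if p + y = y + p then monom (lookup P' p) (wlen p) else 0) = 0" by simp
    qed
    have fy: "f \<in> face y" using y by (auto simp: face_def)
    have "P' \<noteq> 0"
    proof
      assume "P' = 0"
      then have "P = cst (lookup P 0)" by (simp add: P'_def)
      then have "wdeg P = 0" using wdeg_0_iff by blast
      then show False using P by simp
    qed
    have P'C: "P' \<in> centralizer P"
      unfolding P'_def by (intro centralizer_diff centralizer_self centralizer_cst)
    from algebraic_dependence[OF P f this \<open>P' \<noteq> 0\<close>] obtain N \<beta> c where \<beta>: "\<exists>i\<le>N. \<beta> i \<noteq> 0" and eq: "(\<Sum>i\<le>N. cst (\<beta> i) * f ^ i) = c * P'"
      and c: "\<forall>S. subalg S \<longrightarrow> f \<in> S \<longrightarrow> P' \<in> S \<longrightarrow> c \<in> S"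
      by - (erule exE, erule exE, erule exE, erule conjE, erule conjE, rule that)
    have cy: "c \<in> face y" using c subalg_face[of y] fy P'y by blast
    have "degree (phi y f) > 0"
      using y coeff_phi_wlen[of y f] by (intro degree_pos_of_coeff[of _ "wlen y"]) (auto simp: in_keys_iff)
    from phi_dependence_trivial[OF fy P'y cy \<open>phi y P' = 0\<close> this eq] \<beta>
    show False by blast
  qed
qed

text \<open>The same argument with the roles exchanged: now \<open>P\<close> has a nonconstant
  image, so a nonzero element depending on it cannot be killed.\<close>

theorem ex_faithful_face:
  fixes P :: "('k::field, 'x) free_alg"
  assumes P: "wdeg P > 0"
  shows "\<exists>z. centralizer P \<subseteq> face z \<and> (\<forall>c\<in>centralizer P. phi z c = 0 \<longrightarrow> c = 0)"
proof -
  have "P \<noteq> 0" using P by auto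
  then obtain w where "wlen w = wdeg P" "lookup P w \<noteq> 0" using wdeg_top by blast
  then have "w \<in> keys P - {0}" using P by (auto simp: in_keys_iff)
  then obtain z where z: "z \<in> keys P - {0}" "\<forall>w\<in>keys P - {0}. sub w z"
    using ex_sub_max[of "keys P - {0}"] by auto
  have sub: "centralizer P \<subseteq> face z" using z by (intro centralizer_subset_face P) auto
  have deg: "degree (phi z P) > 0"
    using z coeff_phi_wlen[of z P] by (intro degree_pos_of_coeff[of _ "wlen z"]) (auto simp: in_keys_iff)
  have "c = 0" if c: "c \<in> centralizer P" "phi z c = 0" for c
  proof (rule ccontr)
    assume "c \<noteq> 0"
    from algebraic_dependence[OF P centralizer_self c(1) this] obtain N \<beta> d where \<beta>: "\<exists>i\<le>N. \<beta> i \<noteq> 0" and eq: "(\<Sum>i\<le>N. cst (\<beta> i) * P ^ i) = d * c"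
      and d: "\<forall>S. subalg S \<longrightarrow> P \<in> S \<longrightarrow> c \<in> S \<longrightarrow> d \<in> S"
      by - (erule exE, erule exE, erule exE, erule conjE, erule conjE, rule that)
    have cz: "c \<in> face z" and Pz: "P \<in> face z" using sub c centralizer_self[of P] by auto
    have dz: "d \<in> face z" using d subalg_face[of z] cz Pz by blast
    from phi_dependence_trivial[OF Pz cz dz c(2) deg eq] \<beta>
    show False by blast
  qed
  with sub show ?thesis by blast
qed

end

section \<open>Adjoining a central variable\<close>

lemma lookup_map_0: "g 0 = 0 \<Longrightarrow> lookup (Poly_Mapping.map g f) w = g (lookup f w)"
  by (simp add: Poly_Mapping.map.rep_eq when_def)

lemma map_mult:
  fixes f g :: "'x word \<Rightarrow>\<^sub>0 'a::comm_ring_1" and h :: "'a \<Rightarrow> 'b::comm_ring_1"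
  assumes h: "h 0 = 0" "\<And>x y. h (x + y) = h x + h y" "\<And>x y. h (x * y) = h x * h y"
  shows "Poly_Mapping.map h (f * g) = Poly_Mapping.map h f * Poly_Mapping.map h g"
proof (rule poly_mapping_eqI)
  fix w
  have hs: "h (sum k I) = (\<Sum>i\<in>I. h (k i))" for k :: "nat \<Rightarrow> 'a" and I
    by (induction I rule: infinite_finite_induct) (simp_all add: h)
  show "lookup (Poly_Mapping.map h (f * g)) w = lookup (Poly_Mapping.map h f * Poly_Mapping.map h g) w"
    by (simp only: lookup_map_0[of h, OF h(1)] lookup_mult_word hs h(3))
qed

text \<open>
  Elements of \<^typ>\<open>'x word \<Rightarrow>\<^sub>0 'a poly\<close> are polynomials in a central variable \<open>t\<close> over the free algebra;
  \<open>tc n\<close> extracts the coefficient of \<open>t\<^sup>n\<close> and \<open>ev0\<close> sets \<open>t = 0\<close>.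
\<close>

definition emb :: "('x word \<Rightarrow>\<^sub>0 'a::comm_ring_1) \<Rightarrow> 'x word \<Rightarrow>\<^sub>0 'a poly" where
  "emb = Poly_Mapping.map (\<lambda>c. [:c:])"

definition tc :: "nat \<Rightarrow> ('x word \<Rightarrow>\<^sub>0 'a::comm_ring_1 poly) \<Rightarrow> 'x word \<Rightarrow>\<^sub>0 'a" where
  "tc n = Poly_Mapping.map (\<lambda>p. coeff p n)"

definition ev0 :: "('x word \<Rightarrow>\<^sub>0 'a::comm_ring_1 poly) \<Rightarrow> 'x word \<Rightarrow>\<^sub>0 'a" where
  "ev0 = Poly_Mapping.map (\<lambda>p. poly p 0)"

lemma lookup_emb: "lookup (emb f) w = [:lookup f w:]"
  by (simp add: emb_def lookup_map_0)

lemma lookup_tc: "lookup (tc n F) w = coeff (lookup F w) n"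
  by (simp add: tc_def lookup_map_0)

lemma lookup_ev0: "lookup (ev0 F) w = poly (lookup F w) 0"
  by (simp add: ev0_def lookup_map_0)

lemma emb_mult: "emb (f * g) = emb f * emb g"
  unfolding emb_def by (rule map_mult) simp_all

lemma ev0_mult: "ev0 (F * G) = ev0 F * ev0 G"
  unfolding ev0_def by (rule map_mult) simp_all

lemma ev0_diff: "ev0 (F - G) = ev0 F - ev0 G"
  by (rule poly_mapping_eqI) (simp add: lookup_ev0 lookup_minus)

lemma ev0_emb: "ev0 (emb f) = f"
  by (rule poly_mapping_eqI) (simp add: lookup_ev0 lookup_emb)

lemma ev0_cst: "ev0 (cst p) = cst (poly p 0)"
  by (rule poly_mapping_eqI) (simp add: lookup_ev0 lookup_cst)

lemma tc_diff: "tc n (F - G) = tc n F - tc n G"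
  by (rule poly_mapping_eqI) (simp add: lookup_tc lookup_minus)

lemma tc_0 [simp]: "tc n 0 = 0"
  by (rule poly_mapping_eqI) (simp add: lookup_tc)

lemma tc_cst: "tc n (cst p) = cst (coeff p n)"
  by (rule poly_mapping_eqI) (simp add: lookup_tc lookup_cst)

lemma tc_emb: "tc n (emb f) = (if n = 0 then f else 0)"
  by (rule poly_mapping_eqI) (simp add: lookup_tc lookup_emb coeff_pCons split: nat.split)

lemma tc_mult: "tc n (F * G) = (\<Sum>i\<le>n. tc i F * tc (n - i) G)"
  for F G :: "'x word \<Rightarrow>\<^sub>0 'a::comm_ring_1 poly"
proof (rule poly_mapping_eqI)
  fix w
  show "lookup (tc n (F * G)) w = lookup (\<Sum>i\<le>n. tc i F * tc (n - i) G) w"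
    unfolding lookup_sum lookup_tc lookup_mult_word coeff_sum coeff_mult
    by (rule sum.swap)
qed

lemma tc_eqI: "(\<And>n. tc n F = tc n G) \<Longrightarrow> F = G"
proof (rule poly_mapping_eqI, rule poly_eqI)
  fix w n assume "\<And>n. tc n F = tc n G"
  then have "lookup (tc n F) w = lookup (tc n G) w" by simp
  then show "coeff (lookup F w) n = coeff (lookup G w) n" by (simp only: lookup_tc)
qed

lemma tc_emb_mult: "tc n (emb f * G) = f * tc n G"
proof -
  have "tc n (emb f * G) = (\<Sum>i\<le>n. if i = 0 then f * tc n G else 0)"
    unfolding tc_mult by (rule sum.cong) (auto simp: tc_emb)
  then show ?thesis by simp
qed

lemma tc_mult_emb: "tc n (G * emb f) = tc n G * f"
proof -
  have "tc n (G * emb f) = (\<Sum>i\<le>n. if i = n then tc n G * f else 0)"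
    unfolding tc_mult by (rule sum.cong) (auto simp: tc_emb)
  then show ?thesis by simp
qed

lemma centralizer_emb_iff: "F \<in> centralizer (emb P) \<longleftrightarrow> (\<forall>n. tc n F \<in> centralizer P)"
proof
  assume "F \<in> centralizer (emb P)"
  then have "F * emb P = emb P * F" by (simp only: centralizer_iff)
  then have "tc n (F * emb P) = tc n (emb P * F)" for n by simp
  then show "\<forall>n. tc n F \<in> centralizer P" by (simp only: tc_emb_mult tc_mult_emb centralizer_iff) simp
next
  assume "\<forall>n. tc n F \<in> centralizer P"
  then have "F * emb P = emb P * F"
    by (intro tc_eqI) (simp only: tc_emb_mult tc_mult_emb centralizer_iff)
  then show "F \<in> centralizer (emb P)" by (simp only: centralizer_iff)
qed

text \<open>A relation rather than a function, so that zero has no degree in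
  \<open>t\<close>.\<close>

definition is_tdeg :: "('x word \<Rightarrow>\<^sub>0 'a::comm_ring_1 poly) \<Rightarrow> nat \<Rightarrow> bool" where
  "is_tdeg F n \<longleftrightarrow> tc n F \<noteq> 0 \<and> (\<forall>m>n. tc m F = 0)"

lemma is_tdeg_nonzero: "is_tdeg F n \<Longrightarrow> F \<noteq> 0"
  by (auto simp: is_tdeg_def)

lemma is_tdeg_unique: "is_tdeg F n \<Longrightarrow> is_tdeg F m \<Longrightarrow> n = m"
  unfolding is_tdeg_def by (metis linorder_neqE_nat)

lemma ex_is_tdeg:
  assumes "F \<noteq> 0" shows "\<exists>n. is_tdeg F n"
proof -
  define S where "S = {n. tc n F \<noteq> 0}"
  have "S \<subseteq> (\<Union>w\<in>keys F. {..degree (lookup F w)})"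
  proof
    fix n assume "n \<in> S"
    then have "\<exists>w. lookup (tc n F) w \<noteq> 0"
      unfolding S_def by (metis (mono_tags) lookup_zero mem_Collect_eq poly_mapping_eqI)
    then obtain w where "coeff (lookup F w) n \<noteq> 0" by (auto simp: lookup_tc)
    moreover from this have "w \<in> keys F" by (auto simp: in_keys_iff)
    ultimately show "n \<in> (\<Union>w\<in>keys F. {..degree (lookup F w)})"
      by (auto intro!: bexI[of _ w] le_degree)
  qed
  moreover have "finite (\<Union>w\<in>keys F. {..degree (lookup F w)})" by simp
  ultimately have fin: "finite S" by (rule finite_subset)
  have "S \<noteq> {}"
  proof
    assume "S = {}"
    then have "F = 0" by (intro tc_eqI) (auto simp: S_def)
    with assms show False by simp
  qed
  then have "Max S \<in> S" using fin by (rule Max_in[rotated])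
  moreover have "tc m F = 0" if "m > Max S" for m
  proof (rule ccontr)
    assume "tc m F \<noteq> 0"
    then have "m \<le> Max S" using fin by (intro Max_ge) (auto simp: S_def)
    with that show False by simp
  qed
  ultimately show ?thesis unfolding is_tdeg_def S_def by blast
qed

lemma is_tdeg_mult:
  fixes F G :: "'x word \<Rightarrow>\<^sub>0 'a::idom poly"
  assumes F: "is_tdeg F a" and G: "is_tdeg G b"
  shows "is_tdeg (F * G) (a + b)" "tc (a + b) (F * G) = tc a F * tc b G"
proof -
  have 1: "tc (a + b) (F * G) = (\<Sum>i\<le>a + b. if i = a then tc a F * tc b G else 0)"
    unfolding tc_mult
  proof (rule sum.cong[OF refl])
    fix i assume "i \<in> {..a + b}"
    then consider "i = a" | "i > a" | "a + b - i > b" by fastforce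
    then show "tc i F * tc (a + b - i) G = (if i = a then tc a F * tc b G else 0)"
      by cases (use F G in \<open>auto simp: is_tdeg_def\<close>)
  qed
  then show top: "tc (a + b) (F * G) = tc a F * tc b G" by simp
  have "tc m (F * G) = 0" if m: "m > a + b" for m
    unfolding tc_mult
  proof (rule sum.neutral, intro ballI)
    fix i assume "i \<in> {..m}"
    then consider "i > a" | "m - i > b" using m by fastforce
    then show "tc i F * tc (m - i) G = 0"
      by cases (use F G in \<open>auto simp: is_tdeg_def\<close>)
  qed
  then show "is_tdeg (F * G) (a + b)" using F G by (simp add: is_tdeg_def top)
qed

lemma is_tdeg_emb: "u \<noteq> 0 \<Longrightarrow> is_tdeg (emb u) 0"
  by (simp add: is_tdeg_def tc_emb)

lemma is_tdeg_0_emb: "is_tdeg F 0 \<Longrightarrow> F = emb (tc 0 F)"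
  by (rule tc_eqI) (auto simp: is_tdeg_def tc_emb)

lemma coeff_phi: "coeff (phi z f) m = (\<Sum>w\<in>keys f. if w + z = z + w \<and> wlen w = m then lookup f w else 0)"
  unfolding phi_def coeff_sum by (rule sum.cong) auto

text \<open>\<phi> acts on polynomials in \<open>t\<close> coefficient by coefficient, which
  transfers its injectivity from \<open>C\<close> to \<open>C[t]\<close>.\<close>

lemma coeff_coeff_phi: "coeff (coeff (phi z F) m) n = coeff (phi z (tc n F)) m"
proof -
  have sub: "keys (tc n F) \<subseteq> keys F" by (auto simp: in_keys_iff lookup_tc)
  have "coeff (coeff (phi z F) m) n =
     (\<Sum>w\<in>keys F. if w + z = z + w \<and> wlen w = m then coeff (lookup F w) n else 0)"
    unfolding coeff_phi coeff_sum by (rule sum.cong) auto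
  also have "\<dots> = (\<Sum>w\<in>keys F. coeff (if w + z = z + w then monom (lookup (tc n F) w) (wlen w) else 0) m)"
    by (rule sum.cong) (auto simp: lookup_tc)
  also have "\<dots> = coeff (phi z (tc n F)) m"
    by (subst phi_superset[OF finite_keys sub]) (simp only: coeff_sum)
  finally show ?thesis .
qed

lemma coeff_phi_emb: "coeff (phi z (emb f)) m = [:coeff (phi z f) m:]"
  by (rule poly_eqI) (simp add: coeff_coeff_phi tc_emb coeff_pCons split: nat.split)

lemma phi_emb: "phi z (emb f) = map_poly (\<lambda>c. [:c:]) (phi z f)"
  by (rule poly_eqI) (simp add: coeff_phi_emb coeff_map_poly)

text \<open>\<open>emb f\<close> is constant in \<open>t\<close>, so identifying the two variables
  only renames the variable of \<open>phi z f\<close>.\<close>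

lemma poly_phi_emb: "poly (phi z (emb f)) [:0, 1:] = phi z f"
  unfolding phi_emb pcompose_altdef[symmetric] by simp

lemma phi_diff: "phi z (f - g) = phi z f - phi z g"
  using phi_add[of z "f - g" g] by simp

lemma (in word_order) face_poly_iff: "F \<in> face z \<longleftrightarrow> (\<forall>n. tc n F \<in> face z)"
proof
  assume "F \<in> face z"
  moreover have "keys (tc n F) \<subseteq> keys F" for n by (auto simp: in_keys_iff lookup_tc)
  ultimately show "\<forall>n. tc n F \<in> face z" by (auto simp: face_def)
next
  assume F: "\<forall>n. tc n F \<in> face z"
  show "F \<in> face z" unfolding face_def
  proof (intro CollectI ballI)
    fix w assume "w \<in> keys F"
    then have "lookup F w \<noteq> 0" by (simp add: in_keys_iff)
    then have "coeff (lookup F w) (degree (lookup F w)) \<noteq> 0" by simp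
    then have "w \<in> keys (tc (degree (lookup F w)) F)" by (simp only: in_keys_iff lookup_tc not_False_eq_True)
    then show "sub w z" using F by (auto simp: face_def)
  qed
qed

section \<open>Bergman's centralizer theorem\<close>

locale faithful_face = word_order lt for lt :: "'x word \<Rightarrow> 'x word \<Rightarrow> bool" +
  fixes P :: "('k::field, 'x) free_alg" and z :: "'x word"
  assumes subset_face: "centralizer P \<subseteq> face z"
    and faithful: "c \<in> centralizer P \<Longrightarrow> phi z c = 0 \<Longrightarrow> c = 0"
begin

abbreviation C :: "('k, 'x) free_alg set" where "C \<equiv> centralizer P"

abbreviation CT :: "('x word \<Rightarrow>\<^sub>0 'k poly) set" where "CT \<equiv> centralizer (emb P)"

lemma phi_mult_C: "a \<in> C \<Longrightarrow> b \<in> C \<Longrightarrow> phi z (a * b) = phi z a * phi z b"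
  using phi_mult subset_face by blast

lemma phi_inj: "a \<in> C \<Longrightarrow> b \<in> C \<Longrightarrow> phi z a = phi z b \<Longrightarrow> a = b"
  using faithful[of "a - b"] by (simp add: centralizer_diff phi_diff)

lemma C_commute: "a \<in> C \<Longrightarrow> b \<in> C \<Longrightarrow> a * b = b * a"
  by (rule phi_inj) (simp_all add: phi_mult_C centralizer_mult mult.commute)

lemma CT_face: "F \<in> CT \<Longrightarrow> F \<in> face z"
  using subset_face by (auto simp: face_poly_iff centralizer_emb_iff)

lemma phi_mult_CT: "F \<in> CT \<Longrightarrow> G \<in> CT \<Longrightarrow> phi z (F * G) = phi z F * phi z G"
  by (rule phi_mult) (rule CT_face, assumption)+

lemma phi_inj_CT:
  assumes "F \<in> CT" "G \<in> CT" "phi z F = phi z G" shows "F = G"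
proof (rule tc_eqI)
  fix n
  have "phi z (tc n F) = phi z (tc n G)"
    by (rule poly_eqI) (simp only: coeff_coeff_phi[symmetric] assms(3))
  then show "tc n F = tc n G"
    using assms(1,2) by (intro phi_inj) (simp_all only: centralizer_emb_iff)
qed

lemma CT_commute: "F \<in> CT \<Longrightarrow> G \<in> CT \<Longrightarrow> F * G = G * F"
  by (rule phi_inj_CT) (simp_all add: phi_mult_CT centralizer_mult mult.commute)

lemma emb_CT: "c \<in> C \<Longrightarrow> emb c \<in> CT"
  using centralizer_cst[of 0 P] by (simp add: centralizer_emb_iff tc_emb)

lemma constant_iff: "c \<in> C \<Longrightarrow> degree (phi z c) = 0 \<longleftrightarrow> (\<exists>a. c = cst a)"
proof
  assume c: "c \<in> C" and "degree (phi z c) = 0"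
  then obtain a where "phi z c = [:a:]" by (elim degree_eq_zeroE)
  then have "phi z c = phi z (cst a)" by simp
  then show "\<exists>a. c = cst a" using phi_inj[OF c centralizer_cst] by blast
qed auto

lemma constant_CT:
  assumes "F \<in> CT" "degree (phi z F) = 0" shows "\<exists>p. F = cst p"
proof -
  obtain p where "phi z F = [:p:]" using assms(2) by (elim degree_eq_zeroE)
  then have "phi z F = phi z (cst p)" by simp
  then show ?thesis using phi_inj_CT[OF assms(1) centralizer_cst] by blast
qed

text \<open>Applying \<open>\<phi>\<close> to the coefficients of \<open>F \<in> C[t]\<close> yields a polynomial in \<open>t\<close> and the variable of \<open>\<phi>\<close>, which are then identified.\<close>

definition is_root :: "('x word \<Rightarrow>\<^sub>0 'k poly) \<Rightarrow> bool" where
  "is_root F \<longleftrightarrow> F \<in> CT \<and> poly (phi z F) [:0, 1:] = 0"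

lemma root_emb: "is_root (emb c) \<Longrightarrow> c \<in> C \<Longrightarrow> c = 0"
  unfolding is_root_def poly_phi_emb using faithful by blast

lemma root_diff: "is_root F \<Longrightarrow> is_root G \<Longrightarrow> is_root (F - G)"
  by (simp add: is_root_def centralizer_diff phi_diff)

lemma root_mult: "is_root F \<Longrightarrow> G \<in> CT \<Longrightarrow> is_root (F * G)"
  by (simp add: is_root_def centralizer_mult phi_mult_CT)

text \<open>Long division by a root of least degree in \<open>t\<close>: the remainder is again a
  root, of smaller degree, hence zero. Multiplying by the leading coefficient of
  \<open>\<nu>\<close> replaces a division that \<open>C\<close> may not allow.\<close>

lemma pseudo_division:
  assumes \<nu>: "is_root \<nu>" "is_tdeg \<nu> n" and min: "\<And>F m. is_root F \<Longrightarrow> is_tdeg F m \<Longrightarrow> n \<le> m"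
    and F: "is_root F"
  shows "\<exists>l s. l \<in> C \<and> l \<noteq> 0 \<and> s \<in> CT \<and> emb l * F = \<nu> * s"
proof -
  have zero: "\<exists>l s. l \<in> C \<and> l \<noteq> 0 \<and> s \<in> CT \<and> emb l * 0 = \<nu> * s"
    by (rule exI[of _ "cst 1"], rule exI[of _ "cst 0"]) (simp only: centralizer_cst, simp)
  have \<nu>C: "\<nu> \<in> CT" "tc n \<nu> \<in> C" using \<nu>(1) unfolding is_root_def centralizer_emb_iff by blast+
  have "\<exists>l s. l \<in> C \<and> l \<noteq> 0 \<and> s \<in> CT \<and> emb l * F = \<nu> * s" if "is_root F" "is_tdeg F m" for F m
    using that
  proof (induction m arbitrary: F rule: less_induct)
    case (less m)
    have FC: "F \<in> CT" "tc m F \<in> C" using less(2) unfolding is_root_def centralizer_emb_iff by blast+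
    have nm: "n \<le> m" by (rule min[OF less(2,3)])
    \<comment> \<open>Chosen so that \<open>\<nu> * q\<close> and
      \<open>emb (tc n \<nu>) * F\<close> share their term of degree \<open>m\<close> in
      \<open>t\<close>.\<close>
    define q where "q = emb (tc m F) * cst (monom 1 (m - n))"
    have qC: "q \<in> CT" unfolding q_def by (intro centralizer_mult emb_CT FC centralizer_cst)
    have tq: "tc i q = (if i = m - n then tc m F else 0)" for i
      by (simp add: q_def tc_emb_mult tc_cst)
    have tF0: "tc m F \<noteq> 0" using less(3) by (simp add: is_tdeg_def)
    have dq: "is_tdeg q (m - n)" using tF0 by (simp add: is_tdeg_def tq)
    define F1 where "F1 = emb (tc n \<nu>) * F - \<nu> * q"
    have F1: "is_root F1" unfolding F1_def
      using root_mult[OF less(2) emb_CT[OF \<nu>C(2)]] CT_commute[OF FC(1) emb_CT[OF \<nu>C(2)]]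
      by (intro root_diff root_mult[OF \<nu>(1) qC]) simp
    have "tc i F1 = 0" if "i \<ge> m" for i
    proof -
      have d: "is_tdeg (\<nu> * q) m" "tc m (\<nu> * q) = tc n \<nu> * tc m F"
        using is_tdeg_mult[OF \<nu>(2) dq] nm by (simp_all add: tq)
      show ?thesis
      proof (cases "i = m")
        case True then show ?thesis by (simp add: F1_def tc_diff tc_emb_mult d)
      next
        case False
        then have "tc i (\<nu> * q) = 0" "tc i F = 0" using d(1) less(3) that by (auto simp: is_tdeg_def)
        then show ?thesis by (simp add: F1_def tc_diff tc_emb_mult)
      qed
    qed
    note low = this
    have "\<exists>l s. l \<in> C \<and> l \<noteq> 0 \<and> s \<in> CT \<and> emb l * F1 = \<nu> * s"
    proof (cases "F1 = 0")
      case True then show ?thesis using zero by simp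
    next
      case False
      then obtain k where k: "is_tdeg F1 k" using ex_is_tdeg by blast
      then have "k < m" using low[of k] unfolding is_tdeg_def by (metis leI)
      then show ?thesis using less.IH F1 k by blast
    qed
    then obtain l s where l: "l \<in> C" "l \<noteq> 0" and s: "s \<in> CT" and eq: "emb l * F1 = \<nu> * s" by blast
    have "emb (l * tc n \<nu>) * F = emb l * F1 + (emb l * \<nu>) * q"
      unfolding F1_def by (simp add: emb_mult algebra_simps)
    also have "\<dots> = \<nu> * (s + emb l * q)"
      unfolding eq CT_commute[OF emb_CT[OF l(1)] \<nu>C(1)] by (simp add: algebra_simps)
    finally have "emb (l * tc n \<nu>) * F = \<nu> * (s + emb l * q)" .
    moreover have "l * tc n \<nu> \<in> C" by (intro centralizer_mult l \<nu>C)
    moreover have "l * tc n \<nu> \<noteq> 0" using l \<nu>(2) by (simp add: is_tdeg_def)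
    moreover have "s + emb l * q \<in> CT" by (intro centralizer_add centralizer_mult s emb_CT l qC)
    ultimately show ?case by blast
  qed
  then show ?thesis using zero F ex_is_tdeg by (cases "F = 0") blast+
qed

text \<open>Two elements of \<open>C[t]\<close> with a common root are not coprime over the fraction field of \<open>C\<close>.\<close>

lemma common_root:
  assumes f: "is_root f" "is_tdeg f m" and g: "is_root g"
  shows "\<exists>s r k. s \<in> CT \<and> r \<in> CT \<and> is_tdeg s k \<and> k < m \<and> s * g = r * f"
proof -
  define n where "n = (LEAST n. \<exists>F. is_root F \<and> is_tdeg F n)"
  have "\<exists>F. is_root F \<and> is_tdeg F n"
    unfolding n_def by (rule LeastI[of _ m]) (use f in blast)
  then obtain \<nu> where \<nu>: "is_root \<nu>" "is_tdeg \<nu> n" by blast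
  have min: "n \<le> m" if "is_root F" "is_tdeg F m" for F m
    unfolding n_def by (rule Least_le) (use that in blast)
  have \<nu>C: "\<nu> \<in> CT" "f \<in> CT" "g \<in> CT" using \<nu> f g by (auto simp: is_root_def)
  \<comment> \<open>A root of degree zero in \<open>t\<close> would be a nonzero element of
    \<open>C\<close> with image zero.\<close>
  have "n \<noteq> 0"
  proof
    assume "n = 0"
    then have e: "\<nu> = emb (tc 0 \<nu>)" using \<nu> is_tdeg_0_emb by blast
    then have "is_root (emb (tc 0 \<nu>))" using \<nu> by simp
    then have "tc 0 \<nu> = 0" using \<nu>C by (intro root_emb) (simp_all add: centralizer_emb_iff)
    then show False using \<nu> \<open>n = 0\<close> by (simp add: is_tdeg_def)
  qed
  have div: "\<exists>l s. l \<in> C \<and> l \<noteq> 0 \<and> s \<in> CT \<and> emb l * F = \<nu> * s" if "is_root F" for F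
    by (rule pseudo_division[OF \<nu> _ that]) (rule min)
  obtain l s where l: "l \<in> C" "l \<noteq> 0" "s \<in> CT" "emb l * f = \<nu> * s"
    using div[OF f(1)] by blast
  obtain l' r where l': "l' \<in> C" "l' \<noteq> 0" "r \<in> CT" "emb l' * g = \<nu> * r"
    using div[OF g] by blast
  have lf: "is_tdeg (emb l * f) m" using is_tdeg_mult(1)[OF is_tdeg_emb[OF l(2)] f(2)] by simp
  then have "s \<noteq> 0" using l(4) is_tdeg_nonzero by fastforce
  then obtain k where k: "is_tdeg s k" using ex_is_tdeg by blast
  have "is_tdeg (emb l * f) (n + k)" unfolding l(4) by (rule is_tdeg_mult[OF \<nu>(2) k])
  then have "k < m" using is_tdeg_unique[OF lf] \<open>n \<noteq> 0\<close> by simp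
  moreover have "is_tdeg (s * emb l') k" using is_tdeg_mult(1)[OF k is_tdeg_emb[OF l'(2)]] by simp
  moreover have "(s * emb l') * g = (r * emb l) * f"
  proof -
    have "(s * emb l') * g = s * (\<nu> * r)" by (simp only: mult.assoc l'(4))
    also have "\<dots> = (s * \<nu>) * r" by (simp only: mult.assoc)
    also have "s * \<nu> = emb l * f" unfolding l(4) by (rule CT_commute[OF l(3) \<nu>C(1)])
    also have "(emb l * f) * r = r * (emb l * f)"
      by (intro CT_commute centralizer_mult emb_CT l l' \<nu>C)
    finally show ?thesis by (simp only: mult.assoc)
  qed
  moreover have "s * emb l' \<in> CT" "r * emb l \<in> CT" by (intro centralizer_mult emb_CT l l')+
  ultimately show ?thesis by blast
qed

end

section \<open>Divisibility between the elements \<open>graph c\<close>\<close>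

lemma primitive_of_unit_coeff:
  fixes f :: "'x word \<Rightarrow>\<^sub>0 'k::field poly"
  assumes "lookup f w = [:c:]" "c \<noteq> 0" shows "primitive f"
  unfolding primitive_def
proof (intro allI impI notI)
  fix p :: "'k poly" assume p: "prime_elem p" "cdvd p f"
  have "[:c:] dvd 1" using assms(2) by (simp add: is_unit_iff_degree)
  moreover have "p dvd [:c:]" using p(2) assms(1) unfolding cdvd_def by metis
  ultimately have "p dvd 1" by (rule dvd_trans[rotated])
  then show False using p(1) prime_elem_not_unit by blast
qed

context faithful_face
begin

text \<open>When \<open>t\<close> is identified with the variable of \<phi>, both terms have the
  same image; this is the source of the common root.\<close>

definition graph :: "('k, 'x) free_alg \<Rightarrow> 'x word \<Rightarrow>\<^sub>0 'k poly" where
  "graph c = cst (phi z c) - emb c"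

lemma graph_root: "c \<in> C \<Longrightarrow> is_root (graph c)"
  by (simp add: is_root_def graph_def centralizer_diff centralizer_cst emb_CT phi_diff poly_phi_emb)

lemma graph_CT: "c \<in> C \<Longrightarrow> graph c \<in> CT"
  using graph_root by (simp add: is_root_def)

lemma graph_lookup: "w \<noteq> 0 \<Longrightarrow> lookup (graph c) w = [:- lookup c w:]"
  by (simp add: graph_def lookup_minus lookup_emb lookup_cst)

text \<open>Only the coefficient of \<open>t ^ 0\<close> involves \<open>c\<close>, so the leading
  one is a scalar.\<close>

lemma graph_tdeg:
  assumes "degree (phi z c) > 0"
  shows "is_tdeg (graph c) (degree (phi z c))"
    "tc (degree (phi z c)) (graph c) = cst (lead_coeff (phi z c))"
  using assms by (auto simp: is_tdeg_def graph_def tc_diff tc_cst tc_emb coeff_eq_0)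

lemma graph_phi_degree:
  assumes "degree (phi z c) > 0"
  shows "degree (phi z (graph c)) = degree (phi z c)"
proof (rule antisym)
  show "degree (phi z (graph c)) \<le> degree (phi z c)"
    by (rule degree_le)
      (auto simp: graph_def phi_diff coeff_phi_emb coeff_eq_0 coeff_pCons split: nat.split)
  obtain d where d: "degree (phi z c) = Suc d" using assms gr0_implies_Suc by blast
  have "phi z c \<noteq> 0" using assms by auto
  then have "lead_coeff (phi z c) \<noteq> 0" by simp
  moreover have "coeff (phi z (graph c)) (degree (phi z c)) = [:- lead_coeff (phi z c):]"
    by (simp add: graph_def phi_diff coeff_phi_emb d)
  ultimately have "coeff (phi z (graph c)) (degree (phi z c)) \<noteq> 0" by simp
  then show "degree (phi z c) \<le> degree (phi z (graph c))" by (rule le_degree)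
qed

lemma ev0_graph: "ev0 (graph c) = cst (poly (phi z c) 0) - c"
  by (simp add: graph_def ev0_diff ev0_emb ev0_cst)

text \<open>Some coefficient of \<open>F\<close> in \<open>t\<close> contributes to the leading
  coefficient of \<open>phi z F\<close>. It is a nonconstant element of \<open>C\<close>, and its
  image has no larger degree than that of \<open>F\<close>.\<close>

lemma phi_degree_ge:
  assumes F: "F \<in> CT" and pos: "degree (phi z F) > 0"
    and min: "\<And>c. c \<in> C \<Longrightarrow> degree (phi z c) > 0 \<Longrightarrow> \<mu> \<le> degree (phi z c)"
  shows "\<mu> \<le> degree (phi z F)"
proof -
  let ?m = "degree (phi z F)"
  have "phi z F \<noteq> 0" using pos by auto
  then have "coeff (phi z F) ?m \<noteq> 0" by simp
  then obtain n where "coeff (coeff (phi z F) ?m) n \<noteq> 0" by (metis leading_coeff_0_iff)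
  then have nz: "coeff (phi z (tc n F)) ?m \<noteq> 0" by (simp only: coeff_coeff_phi not_False_eq_True)
  let ?k = "degree (phi z (tc n F))"
  have k: "?k > 0" using degree_pos_of_coeff[OF nz pos] .
  have "tc n F \<in> C" using F by (simp add: centralizer_emb_iff)
  then have "\<mu> \<le> ?k" using min k by blast
  moreover have "coeff (phi z (tc n F)) ?k \<noteq> 0" using k by auto
  then have "coeff (coeff (phi z F) ?k) n \<noteq> 0" by (simp only: coeff_coeff_phi not_False_eq_True)
  then have "coeff (phi z F) ?k \<noteq> 0" by auto
  then have "?k \<le> ?m" by (rule le_degree)
  ultimately show ?thesis by simp
qed

text \<open>
  The greatest common left divisor \<open>D\<close> of \<open>\<theta>(t) - T\<close> and \<open>\<phi>\<^sub>c(t) - c\<close>, made primitive,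
  is normalized by \<open>C\<close>; since its leading coefficient in \<open>t\<close> is a scalar, it even commutes with \<open>C\<close>.
\<close>

lemma primitive_gcd:
  assumes T: "T \<in> C" "degree (phi z T) > 0" and c: "c \<in> C" "degree (phi z c) > 0"
  obtains D f1 g1 x y h where "D \<in> CT" "f1 \<in> CT" "graph T = D * f1" "graph c = D * g1"
    "h \<noteq> 0" "cst h * D = graph T * x + graph c * y"
proof -
  define f g where "f = graph T" and "g = graph c"
  have fg: "f \<in> CT" "g \<in> CT" "f \<noteq> 0" "g \<noteq> 0"
    unfolding f_def g_def
    by (rule graph_CT[OF T(1)] graph_CT[OF c(1)] is_tdeg_nonzero[OF graph_tdeg(1)[OF T(2)]]
        is_tdeg_nonzero[OF graph_tdeg(1)[OF c(2)]])+
  \<comment> \<open>The required common right multiple is \<open>f * g = g * f\<close>.\<close>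
  have "\<exists>D. pseudo_gcd f g D"
    by (rule ex_pseudo_gcd[OF fg(3,4,4)]) (rule CT_commute[OF fg(1,2)])
  then obtain D0 x y f' g' d e where D0: "D0 \<noteq> 0" "D0 = f * x + g * y"
    "d \<noteq> 0" "cst d * f = D0 * f'" "e \<noteq> 0" "cst e * g = D0 * g'"
    unfolding pseudo_gcd_def by blast
  obtain h D where h: "h \<noteq> 0" "D0 = cst h * D" "primitive D"
    using primitive_decomp[OF D0(1)] by blast
  have assoc: "(cst h * D) * k = D * (cst h * k)" for k
    by (simp only: cst_mult_assoc mult.assoc)
  obtain f1 where f1: "f = D * f1"
    using gauss_cancel[OF h(3) D0(3), of f "cst h * f'"] D0(4) h(2) assoc by auto
  obtain g1 where g1: "g = D * g1"
    using gauss_cancel[OF h(3) D0(5), of g "cst h * g'"] D0(6) h(2) assoc by auto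
  have D: "D \<noteq> 0" using h(2) D0(1) by auto
  have f1nz: "f1 \<noteq> 0" using f1 fg by auto
  obtain a where a: "is_tdeg D a" using ex_is_tdeg[OF D] by blast
  obtain b where b: "is_tdeg f1 b" using ex_is_tdeg[OF f1nz] by blast
  have ab: "a + b = degree (phi z T)"
    using is_tdeg_mult(1)[OF a b] graph_tdeg(1)[OF T(2)] is_tdeg_unique
    unfolding f1[symmetric] f_def by blast
  \<comment> \<open>The leading coefficient of \<open>f\<close> in \<open>t\<close> is a nonzero
    scalar, and so are its factors, by word length.\<close>
  have "tc a D * tc b f1 = cst (lead_coeff (phi z T))"
    using is_tdeg_mult(2)[OF a b] graph_tdeg(2)[OF T(2)] unfolding f1[symmetric] ab f_def by simp
  then have "wdeg (tc a D * tc b f1) = 0" by simp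
  then have "wdeg (tc a D) = 0" using a b top_mult(2)[of "tc a D" "tc b f1"] by (simp add: is_tdeg_def)
  then obtain \<delta> where \<delta>: "tc a D = cst \<delta>" using wdeg_0_iff by blast
  have \<delta>0: "\<delta> \<noteq> 0" using a \<delta> by (auto simp: is_tdeg_def)
  have comm: "emb u * D = D * emb u" if u: "u \<in> C" for u
  proof (cases "u = 0")
    case True
    have "emb 0 = (0 :: 'x word \<Rightarrow>\<^sub>0 'k poly)" by (rule poly_mapping_eqI) (simp add: lookup_emb)
    with True show ?thesis by simp
  next
    case False
    have uf: "emb u * f = f * emb u" and ug: "emb u * g = g * emb u"
      using CT_commute emb_CT u fg by blast+
    \<comment> \<open>Multiply Bezout's identity for \<open>D\<close> by \<open>u\<close>, which
      commutes with \<open>f\<close> and \<open>g\<close>: after cancelling \<open>h\<close>, the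
      left multiple \<open>emb u * D\<close> is seen to be a right multiple of
      \<open>D\<close>.\<close>
    have "cst h * (emb u * D) = emb u * (cst h * D)" by (rule cst_mult_assoc[symmetric])
    also have "\<dots> = (emb u * f) * x + (emb u * g) * y"
      unfolding h(2)[symmetric] D0(2) by (simp only: distrib_left mult.assoc)
    also have "\<dots> = D * (f1 * emb u * x + g1 * emb u * y)"
      unfolding uf ug by (subst f1, subst g1) (simp only: distrib_left mult.assoc)
    finally obtain \<sigma> where \<sigma>: "emb u * D = D * \<sigma>" using gauss_cancel[OF h(3,1)] by blast
    have "emb u \<noteq> 0" using is_tdeg_nonzero[OF is_tdeg_emb[OF False]] .
    then have "\<sigma> \<noteq> 0" using \<sigma> D by auto
    then obtain k where k: "is_tdeg \<sigma> k" using ex_is_tdeg by blast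
    have 1: "is_tdeg (emb u * D) a" using is_tdeg_mult(1)[OF is_tdeg_emb[OF False] a] by simp
    have 2: "is_tdeg (emb u * D) (a + k)" unfolding \<sigma> by (rule is_tdeg_mult(1)[OF a k])
    have k0: "k = 0" using is_tdeg_unique[OF 1 2] by simp
    then have e: "\<sigma> = emb (tc 0 \<sigma>)" using is_tdeg_0_emb k by blast
    \<comment> \<open>Comparing the coefficients of \<open>t ^ a\<close>, where that of
      \<open>D\<close> is a central scalar, identifies \<sigma> with \<open>u\<close>.\<close>
    have "cst \<delta> * u = u * tc a D" unfolding \<delta> by (rule cst_commute)
    also have "\<dots> = tc a (D * emb (tc 0 \<sigma>))" by (simp only: tc_emb_mult[symmetric] \<sigma> e[symmetric])
    also have "\<dots> = cst \<delta> * tc 0 \<sigma>" by (simp only: tc_mult_emb \<delta>)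
    finally have "u = tc 0 \<sigma>" using \<delta>0 by (intro free_alg_mult_left_cancel[of "cst \<delta>" u]) simp_all
    then show ?thesis using \<sigma> e by simp
  qed
  have DC: "D \<in> CT" using comm[OF centralizer_self] by (simp add: centralizer_iff)
  have "D * (emb P * f1) = D * (f1 * emb P)"
  proof -
    have "D * (emb P * f1) = (D * emb P) * f1" by (simp only: mult.assoc)
    also have "D * emb P = emb P * D" using DC by (simp only: centralizer_iff)
    also have "emb P * D * f1 = emb P * f" by (simp only: f1 mult.assoc)
    also have "\<dots> = f * emb P" using fg(1) by (simp only: centralizer_iff)
    finally show ?thesis by (simp only: f1 mult.assoc)
  qed
  then have "emb P * f1 = f1 * emb P" by (rule free_alg_mult_left_cancel[OF D])
  then have f1C: "f1 \<in> CT" by (simp only: centralizer_iff)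
  show thesis
    by (rule that[OF DC f1C f1[unfolded f_def] g1[unfolded g_def] h(1),
          OF D0(2)[unfolded h(2) f_def g_def]])
qed

text \<open>
  If \<open>\<phi> D\<close> is constant in the variable of \<open>\<phi>\<close>, then \<open>\<theta>(t) - T\<close> divides the cofactor \<open>s\<close> provided by the
  common root, which has smaller degree in \<open>t\<close>. Otherwise \<open>\<phi> D\<close> has full degree, so \<open>D\<close> is an associate
  of \<open>\<theta>(t) - T\<close>.
\<close>

lemma divide_step:
  assumes T: "T \<in> C" "degree (phi z T) > 0"
    and min: "\<And>c. c \<in> C \<Longrightarrow> degree (phi z c) > 0 \<Longrightarrow> degree (phi z T) \<le> degree (phi z c)"
    and c: "c \<in> C" "degree (phi z c) > 0"
  shows "\<exists>g a b. g \<in> C \<and> c - cst a = (T - cst b) * g"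
proof -
  let ?f = "graph T" and ?g = "graph c"
  have fg: "?f \<in> CT" "?g \<in> CT" using T c graph_CT by auto
  obtain D f1 g1 x y h where D: "D \<in> CT" "f1 \<in> CT" "?f = D * f1" "?g = D * g1"
    "h \<noteq> 0" "cst h * D = ?f * x + ?g * y"
    by (rule primitive_gcd[OF T c])
  have "T \<noteq> cst a" for a using T constant_iff by auto
  then have "wdeg T > 0" using wdeg_0_iff by blast
  then have "T \<noteq> 0" by auto
  then obtain w where w: "wlen w = wdeg T" "lookup T w \<noteq> 0" using wdeg_top by blast
  then have "w \<noteq> 0" using \<open>wdeg T > 0\<close> by auto
  \<comment> \<open>This nonzero scalar coefficient makes \<open>graph T\<close> primitive and later
    forces the cofactor \<open>p\<close> to be a unit.\<close>
  then have fw: "lookup ?f w = [:- lookup T w:]" by (rule graph_lookup)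
  have fnz: "?f \<noteq> 0" using graph_tdeg(1)[OF T(2)] is_tdeg_nonzero by blast
  have phif: "phi z ?f = phi z D * phi z f1" unfolding D(3) by (rule phi_mult_CT[OF D(1,2)])
  have "phi z ?f \<noteq> 0" using graph_phi_degree[OF T(2)] T(2) by auto
  then have deg: "degree (phi z T) = degree (phi z D) + degree (phi z f1)"
    using graph_phi_degree[OF T(2)] unfolding phif by (auto simp: degree_mult_eq)
  show ?thesis
  proof (cases "degree (phi z D) = 0")
    case True
    then obtain q where q: "D = cst q" using constant_CT[OF D(1)] by blast
    have "h * q \<noteq> 0" using D(3,5) fnz q by auto
    have hq: "cst (h * q) = ?f * x + ?g * y" using D(6) by (simp add: q cst_mult)
    obtain s r k where s: "s \<in> CT" "r \<in> CT" "is_tdeg s k" "k < degree (phi z T)" "s * ?g = r * ?f"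
      using common_root[OF graph_root[OF T(1)] graph_tdeg(1)[OF T(2)] graph_root[OF c(1)]] by blast
    \<comment> \<open>Multiplying Bezout's identity by \<open>s\<close> and replacing
      \<open>s * ?g\<close> by \<open>r * ?f\<close> turns every term into a multiple of
      \<open>?f\<close>.\<close>
    have "cst (h * q) * s = s * (?f * x + ?g * y)" unfolding hq[symmetric] by (rule cst_commute)
    also have "\<dots> = (s * ?f) * x + (r * ?f) * y" by (simp only: distrib_left mult.assoc[symmetric] s(5))
    also have "\<dots> = (?f * s) * x + (?f * r) * y"
      by (simp only: CT_commute[OF s(1) fg(1)] CT_commute[OF s(2) fg(1)])
    also have "\<dots> = ?f * (s * x + r * y)" by (simp only: distrib_left mult.assoc)
    finally obtain e where e: "s = ?f * e"
      using gauss_cancel[OF primitive_of_unit_coeff[OF fw] \<open>h * q \<noteq> 0\<close>] w by auto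
    have "e \<noteq> 0" using e is_tdeg_nonzero[OF s(3)] by auto
    then obtain j where j: "is_tdeg e j" using ex_is_tdeg by blast
    have "is_tdeg s (degree (phi z T) + j)"
      unfolding e by (rule is_tdeg_mult[OF graph_tdeg(1)[OF T(2)] j])
    then have "k = degree (phi z T) + j" using is_tdeg_unique[OF s(3)] by blast
    with s(4) show ?thesis by simp
  next
    case False
    then have "degree (phi z T) \<le> degree (phi z D)"
      using phi_degree_ge[OF D(1) _ min] by simp
    then have "degree (phi z f1) = 0" using deg by simp
    then obtain p where p: "f1 = cst p" using constant_CT[OF D(2)] by blast
    have "lookup D w * p = [:- lookup T w:]" using fw unfolding D(3) p by simp
    then have pd: "p dvd [:- lookup T w:]" by (metis dvd_triv_right)
    have "[:- lookup T w:] dvd 1" using w by (simp add: is_unit_iff_degree)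
    then have "p dvd 1" using dvd_trans[OF pd] by blast
    then obtain p' where p': "1 = p * p'" by (rule dvdE)
    have "D = ?f * cst p'"
      unfolding D(3) p mult.assoc cst_mult[symmetric] p'[symmetric] by simp
    then have "?g = ?f * (cst p' * g1)" using D(4) by (simp only: mult.assoc)
    then have "ev0 ?g = ev0 ?f * ev0 (cst p' * g1)" by (metis ev0_mult)
    then have eq: "c - cst (poly (phi z c) 0) = (T - cst (poly (phi z T) 0)) * ev0 (cst p' * g1)"
      unfolding ev0_graph by (simp add: algebra_simps)
    define T' G where "T' = T - cst (poly (phi z T) 0)" and "G = ev0 (cst p' * g1)"
    have T'C: "T' \<in> C" unfolding T'_def by (intro centralizer_diff T centralizer_cst)
    have T'0: "T' \<noteq> 0" unfolding T'_def using \<open>\<And>a. T \<noteq> cst a\<close> by simp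
    have "T' * G \<in> C" unfolding T'_def G_def eq[symmetric]
      by (intro centralizer_diff c centralizer_cst)
    then have "T' * (G * P) = P * (T' * G)" by (simp only: centralizer_iff mult.assoc)
    also have "\<dots> = T' * (P * G)" using T'C by (simp only: centralizer_iff mult.assoc[symmetric])
    finally have "G * P = P * G" by (rule free_alg_mult_left_cancel[OF T'0])
    then have "G \<in> C" by (simp only: centralizer_iff)
    then show ?thesis using eq unfolding G_def by blast
  qed
qed

end

section \<open>Polynomials evaluated at an element, and the centralizer theorem\<close>

definition peval :: "'k::field poly \<Rightarrow> ('k, 'x) free_alg \<Rightarrow> ('k, 'x) free_alg" where
  "peval p T = (\<Sum>i\<le>degree p. cst (coeff p i) * T ^ i)"

lemma peval_eq_sum:
  assumes "degree p \<le> n" shows "peval p T = (\<Sum>i\<le>n. cst (coeff p i) * T ^ i)"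
  unfolding peval_def using assms
  by (intro sum.mono_neutral_left) (auto simp: coeff_eq_0)

lemma peval_add: "peval (p + q) T = peval p T + peval q T"
proof -
  let ?n = "max (degree p) (degree q)"
  have "peval (p + q) T = (\<Sum>i\<le>?n. cst (coeff (p + q) i) * T ^ i)"
    by (rule peval_eq_sum) (rule degree_add_le_max)
  also have "\<dots> = (\<Sum>i\<le>?n. cst (coeff p i) * T ^ i) + (\<Sum>i\<le>?n. cst (coeff q i) * T ^ i)"
    by (simp add: single_add distrib_right sum.distrib)
  also have "\<dots> = peval p T + peval q T"
    by (simp only: peval_eq_sum[of p ?n] peval_eq_sum[of q ?n] max.cobounded1 max.cobounded2)
  finally show ?thesis .
qed

lemma peval_const [simp]: "peval [:a:] T = cst a"
  by (simp add: peval_def)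

lemma peval_0 [simp]: "peval 0 T = 0"
  by (simp add: peval_def)

lemma peval_pCons: "peval (pCons a p) T = cst a + T * peval p T"
proof -
  have "peval (pCons a p) T = (\<Sum>i\<le>Suc (degree p). cst (coeff (pCons a p) i) * T ^ i)"
    by (rule peval_eq_sum) (rule degree_pCons_le)
  also have "\<dots> = cst a + (\<Sum>i\<le>degree p. cst (coeff p i) * (T * T ^ i))"
    by (subst sum.atMost_Suc_shift) simp
  also have "(\<Sum>i\<le>degree p. cst (coeff p i) * (T * T ^ i)) = T * peval p T"
    unfolding peval_def sum_distrib_left by (intro sum.cong refl) (rule cst_mult_assoc[symmetric])
  finally show ?thesis .
qed

lemma peval_smult: "peval (smult a p) T = cst a * peval p T"
  by (induction p) (simp_all add: peval_pCons distrib_left cst_mult cst_mult_assoc)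

lemma peval_mult: "peval (p * q) T = peval p T * peval q T"
  by (induction p) (simp_all add: peval_pCons peval_add peval_smult distrib_right mult.assoc)

lemma peval_uminus: "peval (- p) T = - peval p T"
  using peval_add[of p "- p" T] by (simp add: eq_neg_iff_add_eq_0 add.commute)

lemma peval_diff: "peval (p - q) T = peval p T - peval q T"
  using peval_add[of p "- q" T] by (simp add: peval_uminus)

lemma peval_1 [simp]: "peval 1 T = 1"
  using peval_const[of 1 T] by (simp add: one_pCons del: peval_const)

lemma peval_X [simp]: "peval [:0, 1:] T = T"
  by (simp add: peval_pCons)

lemma poly_in_eq_peval: "poly_in n \<alpha> T = peval (\<Sum>i\<le>n. monom (\<alpha> i) i) T"
proof -
  have "degree (\<Sum>i\<le>n. monom (\<alpha> i) i) \<le> n"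
    by (rule degree_sum_le) (auto intro: order_trans[OF degree_monom_le])
  then show ?thesis by (simp add: peval_eq_sum poly_in_def scalar_def coeff_sum_monom)
qed

lemma range_poly_in: "{poly_in n \<alpha> T | n \<alpha>. True} = range (\<lambda>p. peval p T)"
proof -
  have "peval p T = poly_in (degree p) (coeff p) T" for p
    by (simp add: peval_def poly_in_def scalar_def)
  then show ?thesis unfolding poly_in_eq_peval by blast
qed

text \<open>Commutativity is recorded as well because it shows that the generator \<open>T\<close>
  has the same centralizer as \<open>P\<close>.\<close>

theorem bergman_centralizer:
  fixes P :: "('k::field, 'x) free_alg"
  assumes P: "wdeg P > 0"
  shows "\<exists>T\<in>centralizer P. wdeg T > 0 \<and> centralizer P = range (\<lambda>p. peval p T)"
    "a \<in> centralizer P \<Longrightarrow> b \<in> centralizer P \<Longrightarrow> a * b = b * a"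
proof -
  obtain lt :: "'x word \<Rightarrow> 'x word \<Rightarrow> bool" where "word_order lt" using ex_word_order by blast
  then interpret word_order lt .
  obtain z where z: "centralizer P \<subseteq> face z" "\<forall>c\<in>centralizer P. phi z c = 0 \<longrightarrow> c = 0"
    using ex_faithful_face[OF P] by blast
  interpret faithful_face lt P z by unfold_locales (use z in auto)
  show "a \<in> C \<Longrightarrow> b \<in> C \<Longrightarrow> a * b = b * a" by (rule C_commute)
  define \<mu> where "\<mu> = (LEAST m. \<exists>T\<in>C. degree (phi z T) = m \<and> m > 0)"
  have "degree (phi z P) \<noteq> 0"
    using constant_iff[OF centralizer_self] P by auto
  then have "\<exists>T\<in>C. degree (phi z T) = degree (phi z P) \<and> degree (phi z P) > 0"
    by (intro bexI[of _ P] centralizer_self) simp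
  then have "\<exists>T\<in>C. degree (phi z T) = \<mu> \<and> \<mu> > 0"
    unfolding \<mu>_def by (rule LeastI)
  then obtain T where T: "T \<in> C" "degree (phi z T) = \<mu>" "degree (phi z T) > 0" by metis
  have min: "degree (phi z T) \<le> degree (phi z c)" if "c \<in> C" "degree (phi z c) > 0" for c
    unfolding T(2) \<mu>_def by (rule Least_le) (use that in auto)
  have "wdeg T > 0"
    using constant_iff[OF T(1)] T(3) wdeg_0_iff[of T] by auto
  have pC: "peval p T \<in> C" for p
    unfolding peval_def by (intro centralizer_sum centralizer_mult centralizer_cst centralizer_power T)
  have "c \<in> range (\<lambda>p. peval p T)" if "c \<in> C" for c
    using that
  proof (induction "degree (phi z c)" arbitrary: c rule: less_induct)
    case less
    show ?case
    proof (cases "degree (phi z c) = 0")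
      case True
      then obtain a where "c = cst a" using constant_iff less by blast
      then show ?thesis by (intro image_eqI[of _ _ "[:a:]"]) simp_all
    next
      case False
      then obtain g a b where g: "g \<in> C" and eq: "c - cst a = (T - cst b) * g"
        using divide_step[OF T(1,3) min less(2)] by blast
      \<comment> \<open>Degrees add in products of images, and subtracting scalars does not change a
        positive degree.\<close>
      have "degree (phi z g) < degree (phi z c)"
      proof (cases "phi z g = 0")
        case True then show ?thesis using False by simp
      next
        case g0: False
        have 1: "phi z c = [:a:] + (phi z T - [:b:]) * phi z g"
        proof -
          have "phi z c = phi z (cst a + (T - cst b) * g)" by (simp only: eq[symmetric]) simp
          also have "\<dots> = [:a:] + (phi z T - [:b:]) * phi z g"
            by (simp only: phi_add phi_cst phi_diff phi_mult_C centralizer_diff centralizer_cst T g)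
          finally show ?thesis .
        qed
        have "degree (phi z T + - [:b:]) = degree (phi z T)"
          by (rule degree_add_eq_left) (use T(3) in simp)
        then have dT: "degree (phi z T - [:b:]) = degree (phi z T)"
          by (simp only: diff_conv_add_uminus)
        then have T0: "phi z T - [:b:] \<noteq> 0" using T(3) by auto
        have "degree ((phi z T - [:b:]) * phi z g) = degree (phi z T) + degree (phi z g)"
          by (simp add: degree_mult_eq[OF T0 g0] dT)
        then have "degree (phi z c) = degree (phi z T) + degree (phi z g)"
          unfolding 1 using T(3) by (subst degree_add_eq_right) simp_all
        then show ?thesis using T(3) by simp
      qed
      from less(1)[OF this g] obtain p where p: "g = peval p T" by blast
      have "c = cst a + (T - cst b) * g" by (simp only: eq[symmetric]) simp
      also have "\<dots> = peval ([:a:] + ([:0, 1:] - [:b:]) * p) T"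
        by (simp only: peval_add peval_mult peval_diff peval_const peval_X p)
      finally show ?thesis by blast
    qed
  qed
  then have "C = range (\<lambda>p. peval p T)" using pC by blast
  then show "\<exists>T\<in>C. wdeg T > 0 \<and> C = range (\<lambda>p. peval p T)"
    using T \<open>wdeg T > 0\<close> by blast
qed

section \<open>Self-generating elements\<close>

lemma wdeg_pos_iff: "wdeg P > 0 \<longleftrightarrow> (\<forall>c. P \<noteq> cst c)"
  using wdeg_0_iff[of P] by auto

lemma invertible_iff: "invertible_elem P \<longleftrightarrow> (\<exists>c. c \<noteq> 0 \<and> P = cst c)"
  for P :: "('k::field, 'x) free_alg"
proof
  assume "invertible_elem P"
  then obtain R where R: "P * R = 1" by (auto simp: invertible_elem_def)
  then have nz: "P \<noteq> 0" "R \<noteq> 0" by auto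
  have "wdeg (1 :: ('k, 'x) free_alg) = 0"
    using wdeg_cst[where c = "1 :: 'k"] by (simp del: wdeg_cst)
  then have "wdeg P = 0" using top_mult(2)[OF nz] R by simp
  then obtain c where "P = cst c" using wdeg_0_iff by blast
  with nz show "\<exists>c. c \<noteq> 0 \<and> P = cst c" by auto
next
  assume "\<exists>c. c \<noteq> 0 \<and> P = cst c"
  then obtain c where c: "c \<noteq> 0" "P = cst c" by blast
  have "cst c * (cst (inverse c) :: ('k, 'x) free_alg) = 1" "cst (inverse c) * (cst c :: ('k, 'x) free_alg) = 1"
    unfolding cst_mult[symmetric] using c(1) by simp_all
  then show "invertible_elem P" unfolding invertible_elem_def c(2) by blast
qed

text \<open>Makes the ground field definable, so that formulas can quantify over it.\<close>

lemma scalar_iff: "P = 0 \<or> invertible_elem P \<longleftrightarrow> (\<exists>c. P = cst c)"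
  for P :: "('k::field, 'x) free_alg"
proof -
  have "(0 :: ('k, 'x) free_alg) = cst 0" by simp
  then show ?thesis unfolding invertible_iff by (metis cst_eq_0_iff)
qed

abbreviation var :: "'x \<Rightarrow> 'x word \<Rightarrow>\<^sub>0 'a::zero_neq_one" where
  "var a \<equiv> Poly_Mapping.single (Word [a]) 1"

lemma peval_zero: "peval p 0 = cst (poly p 0)"
  by (cases p) (simp add: peval_pCons)

lemma self_generates_iff: "self_generates P \<longleftrightarrow> centralizer P = range (\<lambda>p. peval p P)"
  unfolding self_generates_def range_poly_in ..

text \<open>The only non-invertible scalar is 0; it does not generate, since everything commutes
  with it while its polynomials are scalars.\<close>

lemma nsg_iff:
  "P \<in> noninv_self_generating \<longleftrightarrow> wdeg P > 0 \<and> centralizer P = range (\<lambda>p. peval p P)"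
  for P :: "('k::field, 'x) free_alg"
proof -
  have "wdeg P > 0" if n: "\<not> invertible_elem P" and r: "centralizer P = range (\<lambda>p. peval p P)"
  proof (rule ccontr)
    assume "\<not> wdeg P > 0"
    then obtain c where c: "P = cst c" using wdeg_pos_iff[of P] by auto
    with n have "c = 0" by (auto simp: invertible_iff)
    with c have P: "P = 0" by simp
    \<comment> \<open>Types are inhabited, so there is a letter, and a letter is not a
      scalar.\<close>
    fix a :: 'x
    have "var a \<in> centralizer P" by (simp add: P centralizer_def)
    then obtain p where "var a = peval p P" using r by blast
    then have "lookup (var a :: ('k, 'x) free_alg) (Word [a]) = lookup (cst (poly p 0)) (Word [a])"
      unfolding P peval_zero by (rule arg_cong)
    then show False by (simp add: lookup_cst_Word)
  qed
  moreover have "\<not> invertible_elem P" if "wdeg P > 0"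
    using that unfolding invertible_iff wdeg_pos_iff by auto
  ultimately show ?thesis
    unfolding noninv_self_generating_def self_generates_iff by blast
qed

text \<open>By degree, a nonzero multiple of a nonscalar element is never a scalar; hence
  \<open>P\<close> is transcendental over \<open>K\<close>.\<close>

lemma peval_eq_0:
  fixes P :: "('k::field, 'x) free_alg"
  assumes P: "wdeg P > 0" shows "peval p P = 0 \<Longrightarrow> p = 0"
proof (induction p)
  case (pCons a p)
  have "p = 0"
  proof (rule ccontr)
    assume "p \<noteq> 0"
    with pCons have nz: "peval p P \<noteq> 0" by auto
    have "P \<noteq> 0" using P by auto
    have "P * peval p P = cst (- a)"
      using pCons(3) by (simp add: peval_pCons single_uminus eq_neg_iff_add_eq_0 add.commute)
    then have "wdeg (P * peval p P) = 0" by simp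
    then show False using top_mult(2)[OF \<open>P \<noteq> 0\<close> nz] P by simp
  qed
  then show ?case using pCons by (simp add: peval_pCons)
qed simp

lemma peval_inj:
  fixes P :: "('k::field, 'x) free_alg"
  assumes "wdeg P > 0" "peval p P = peval q P" shows "p = q"
  using peval_eq_0[OF assms(1), of "p - q"] assms(2) by (simp add: peval_diff)

lemma peval_centralizer: "a \<in> centralizer T \<Longrightarrow> a \<in> centralizer (peval p T)"
proof -
  assume "a \<in> centralizer T"
  then have "T \<in> centralizer a" by (simp add: centralizer_iff)
  then have "peval p T \<in> centralizer a"
    unfolding peval_def by (intro centralizer_sum centralizer_mult centralizer_cst centralizer_power)
  then show ?thesis by (simp add: centralizer_iff)
qed

text \<open>The polynomial represented by \<open>x\<close>; meaningful only if \<open>x \<in> centralizer P\<close> and \<open>P\<close> self-generates its centralizer.\<close>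

definition coord :: "('k::field, 'x) free_alg \<Rightarrow> ('k, 'x) free_alg \<Rightarrow> 'k poly" where
  "coord P x = (THE p. peval p P = x)"

lemma coord_peval: "wdeg P > 0 \<Longrightarrow> coord P (peval p P) = p"
  unfolding coord_def by (rule the_equality) (auto dest: peval_inj)

text \<open>\<open>K[P]\<close> is commutative, whereas two distinct letters do not commute.\<close>

lemma nsg_centralizer_proper:
  assumes "\<exists>a b :: 'x. a \<noteq> b" and P: "centralizer P = (UNIV :: ('k::field, 'x) free_alg set)"
  shows "P \<notin> noninv_self_generating"
proof
  assume nsg: "P \<in> noninv_self_generating"
  obtain a b :: 'x where ab: "a \<noteq> b" using assms by blast
  have r: "range (\<lambda>p. peval p P) = UNIV" using nsg P by (simp add: nsg_iff)
  obtain p q where p: "var a = peval p P" and q: "var b = peval q P"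
    using r by (metis rangeE UNIV_I)
  have "var a * var b = (var b * var a :: ('k, 'x) free_alg)"
    unfolding p q peval_mult[symmetric] by (simp only: mult.commute)
  then have "Poly_Mapping.single (Word [a, b]) (1 :: 'k) = Poly_Mapping.single (Word [b, a]) 1"
    by (simp add: mult_single plus_word_def)
  then have "lookup (Poly_Mapping.single (Word [a, b]) (1 :: 'k)) (Word [a, b]) =
     lookup (Poly_Mapping.single (Word [b, a]) 1) (Word [a, b])" by (rule arg_cong)
  then show False using ab by (simp add: lookup_single when_def)
qed

text \<open>Bergman's generator \<open>T\<close> has the same centralizer as \<open>P\<close>,
  because \<open>P\<close> is a polynomial in \<open>T\<close> and the centralizer of
  \<open>P\<close> is commutative.\<close>

lemma proper_centralizers_eq:
  assumes "\<exists>a b :: 'x. a \<noteq> b"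
  shows "(proper_centralizers :: ('k::field, 'x) free_alg set set) = centralizer ` noninv_self_generating"
proof
  show "centralizer ` noninv_self_generating \<subseteq> (proper_centralizers :: ('k, 'x) free_alg set set)"
    using nsg_centralizer_proper[OF assms] unfolding proper_centralizers_def by blast
  show "(proper_centralizers :: ('k, 'x) free_alg set set) \<subseteq> centralizer ` noninv_self_generating"
  proof
    fix S :: "('k, 'x) free_alg set" assume "S \<in> proper_centralizers"
    then obtain P where P: "S = centralizer P" "centralizer P \<noteq> UNIV"
      unfolding proper_centralizers_def by blast
    have pos: "wdeg P > 0"
    proof (rule ccontr)
      assume "\<not> wdeg P > 0"
      then obtain c where "P = cst c" using wdeg_pos_iff[of P] by auto
      then have "centralizer P = UNIV" by (auto simp: centralizer_def cst_commute)
      with P show False by blast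
    qed
    obtain T where T: "T \<in> centralizer P" "wdeg T > 0" "centralizer P = range (\<lambda>p. peval p T)"
      using bergman_centralizer(1)[OF pos] by blast
    obtain p where p: "P = peval p T" using centralizer_self[of P] T(3) by blast
    have "centralizer T = centralizer P"
    proof
      show "centralizer T \<subseteq> centralizer P" unfolding p using peval_centralizer by blast
      show "centralizer P \<subseteq> centralizer T"
        using bergman_centralizer(2)[OF pos _ T(1)] by (auto simp: centralizer_iff)
    qed
    with T P have "T \<in> noninv_self_generating" "S = centralizer T" by (simp_all add: nsg_iff)
    then show "S \<in> centralizer ` noninv_self_generating" by blast
  qed
qed

lemma ex_nsg:
  assumes "\<exists>a b :: 'x. a \<noteq> b"
  shows "\<exists>P :: ('k::field, 'x) free_alg. P \<in> noninv_self_generating"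
proof -
  obtain a b :: 'x where ab: "a \<noteq> b" using assms by blast
  have "\<not> (var b \<in> centralizer (var a :: ('k, 'x) free_alg))"
  proof
    assume "var b \<in> centralizer (var a :: ('k, 'x) free_alg)"
    then have "Poly_Mapping.single (Word [a, b]) (1 :: 'k) = Poly_Mapping.single (Word [b, a]) 1"
      by (simp add: centralizer_iff mult_single plus_word_def)
    then have "lookup (Poly_Mapping.single (Word [a, b]) (1 :: 'k)) (Word [a, b]) =
       lookup (Poly_Mapping.single (Word [b, a]) 1) (Word [a, b])" by (rule arg_cong)
    then show False using ab by (simp add: lookup_single when_def)
  qed
  then have "centralizer (var a :: ('k, 'x) free_alg) \<in> proper_centralizers"
    unfolding proper_centralizers_def by blast
  then show ?thesis unfolding proper_centralizers_eq[OF assms] by blast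
qed

section \<open>Definability of the self-generating elements\<close>

lemma sat_unit_fm:
  fixes e :: "nat \<Rightarrow> 'a::ring_1"
  assumes "i \<noteq> j" shows "sat e (unit_fm i j) \<longleftrightarrow> invertible_elem (e i)"
  using assms by (simp add: unit_fm_def invertible_elem_def)

lemma sat_scalar_fm:
  fixes e :: "nat \<Rightarrow> ('k::field, 'x) free_alg"
  assumes "i \<noteq> j" shows "sat e (scalar_fm i j) \<longleftrightarrow> (\<exists>c. e i = cst c)"
  unfolding scalar_iff[symmetric] by (simp add: scalar_fm_def sat_unit_fm[OF assms])

lemma sat_commute_fm: "sat e (commute_fm i j) \<longleftrightarrow> e i \<in> centralizer (e j)"
  for e :: "nat \<Rightarrow> 'a::ring_1"
  by (simp add: commute_fm_def centralizer_iff)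

text \<open>Cancelling \<open>P\<close> shows that the quotient \<open>r\<close> commutes with
  \<open>P\<close> again. Its degree is smaller than that of \<open>q\<close>, so iterating the
  division writes \<open>q\<close> as a polynomial in \<open>P\<close>.\<close>

lemma nsg_iff_divisible:
  "P \<in> noninv_self_generating \<longleftrightarrow>
    \<not> invertible_elem P \<and> (\<forall>q\<in>centralizer P. \<exists>a r. q = cst a + P * r)"
  for P :: "('k::field, 'x) free_alg"
proof
  assume P: "P \<in> noninv_self_generating"
  have "\<exists>a r. q = cst a + P * r" if q: "q \<in> centralizer P" for q
  proof -
    obtain p where p: "q = peval p P" using P q by (auto simp: nsg_iff)
    obtain a p' where "p = pCons a p'" by (cases p)
    then show ?thesis using p peval_pCons by blast
  qed
  then show "\<not> invertible_elem P \<and> (\<forall>q\<in>centralizer P. \<exists>a r. q = cst a + P * r)"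
    using P by (simp add: noninv_self_generating_def)
next
  assume *: "\<not> invertible_elem P \<and> (\<forall>q\<in>centralizer P. \<exists>a r. q = cst a + P * r)"
  show "P \<in> noninv_self_generating"
  proof -
    have pos: "wdeg P > 0"
    proof (rule ccontr)
      assume "\<not> wdeg P > 0"
      then obtain c where c: "P = cst c" using wdeg_pos_iff[of P] by auto
      with * have "c = 0" unfolding invertible_iff by blast
      with c have P: "P = 0" by simp
      fix x :: 'x
      have "var x \<in> centralizer P" by (simp add: P centralizer_def)
      then obtain a where a: "var x = (cst a :: ('k, 'x) free_alg)" using * P by auto
      have "lookup (var x :: ('k, 'x) free_alg) (Word [x]) = lookup (cst a) (Word [x])"
        using a by (rule arg_cong)
      then show False by (simp add: lookup_cst_Word)
    qed
    then have P0: "P \<noteq> 0" by auto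
    have "q \<in> range (\<lambda>p. peval p P)" if "q \<in> centralizer P" for q
      using that
    proof (induction "wdeg q" arbitrary: q rule: less_induct)
      case less
      obtain a r where q: "q = cst a + P * r" using * less(2) by blast
      have "P * r = q - cst a" by (simp add: q)
      then have "P * r \<in> centralizer P" by (simp only: centralizer_diff less(2) centralizer_cst)
      then have "P * (r * P) = P * (P * r)" by (simp only: centralizer_iff mult.assoc)
      then have rC: "r \<in> centralizer P" unfolding centralizer_iff by (rule free_alg_mult_left_cancel[OF P0])
      show ?case
      proof (cases "r = 0")
        case True
        then show ?thesis using q by (intro image_eqI[of _ _ "[:a:]"]) simp_all
      next
        case False
        have "wdeg r < wdeg (P * r)" using top_mult(2)[OF P0 False] pos by simp
        \<comment> \<open>Adding a scalar cannot lower the positive degree of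
          \<open>P * r\<close>.\<close>
        also have "wdeg (P * r) \<le> wdeg q"
        proof (rule ccontr)
          assume "\<not> ?thesis"
          then have "dlt q (wdeg (P * r))" "dlt (cst a :: ('k, 'x) free_alg) (wdeg (P * r))"
            by (auto simp: dlt_iff_wdeg)
          then have "dlt (q - cst a) (wdeg (P * r))" by (rule dlt_diff)
          then have "dlt (P * r) (wdeg (P * r))" by (simp add: q)
          then show False using P0 False by (simp add: dlt_iff_wdeg)
        qed
        finally obtain p where "r = peval p P" using less(1) rC by blast
        then have "q = peval (pCons a p) P" by (simp add: q peval_pCons)
        then show ?thesis by blast
      qed
    qed
    moreover have "peval p P \<in> centralizer P" for p
      unfolding peval_def by (intro centralizer_sum centralizer_mult centralizer_cst centralizer_power centralizer_self)
    ultimately show ?thesis using pos by (auto simp: nsg_iff)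
  qed
qed

text \<open>
  A variant of \<^const>\<open>self_gen_fm\<close> whose bound variables are above \<open>20\<close>, so that any \<open>i < 20\<close> may be free;
  similarly for \<open>Is_at\<close> below.
\<close>

definition self_gen_at :: "nat \<Rightarrow> fm" where
  "self_gen_at i =
     Conj (Neg (unit_fm i 24))
       (All 21 (Imp (commute_fm 21 i)
          (Ex 22 (Ex 23 (Conj (scalar_fm 22 24)
             (Eq (Var 21) (Add (Var 22) (Mul (Var i) (Var 23)))))))))"

lemma sat_self_gen_at:
  fixes e :: "nat \<Rightarrow> ('k::field, 'x) free_alg"
  assumes "i < 20" shows "sat e (self_gen_at i) \<longleftrightarrow> e i \<in> noninv_self_generating"
  unfolding nsg_iff_divisible self_gen_at_def using assms
  by (auto simp: sat_unit_fm sat_scalar_fm sat_commute_fm) blast+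

lemma sat_self_gen_fm: "sat e self_gen_fm \<longleftrightarrow> e 0 \<in> noninv_self_generating"
  for e :: "nat \<Rightarrow> ('k::field, 'x) free_alg"
  unfolding nsg_iff_divisible self_gen_fm_def
  by (auto simp: sat_unit_fm sat_scalar_fm sat_commute_fm) blast+

lemma self_gen_fm_defines:
  "defined_by self_gen_fm 1 {[P] | P :: ('k::field, 'x) free_alg. P \<in> noninv_self_generating}"
proof -
  have "free_vars self_gen_fm \<subseteq> {..<1}"
    by (auto simp: self_gen_fm_def unit_fm_def scalar_fm_def commute_fm_def)
  moreover have "{[P] | P :: ('k, 'x) free_alg. P \<in> noninv_self_generating} =
      {as. length as = 1 \<and> models self_gen_fm as}"
    by (auto simp: models_def sat_self_gen_fm length_Suc_conv)
  ultimately show ?thesis unfolding defined_by_def by blast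
qed

section \<open>Definability of the isomorphisms between centralizers\<close>

text \<open>The meaning of \<open>Is_fm\<close> in the free algebra; the summands are arranged so
  that no subtraction occurs, for which the language has no symbol.\<close>

definition same_values ::
  "('k::field, 'x) free_alg \<Rightarrow> ('k, 'x) free_alg \<Rightarrow> ('k, 'x) free_alg \<Rightarrow> ('k, 'x) free_alg \<Rightarrow> bool"
where
  "same_values x y u v \<longleftrightarrow> x \<in> centralizer u \<and> y \<in> centralizer v \<and>
     (\<forall>a. \<exists>b. (\<exists>r. x + cst a * r = cst b + u * r) \<and> (\<exists>r. y + cst a * r = cst b + v * r))"

text \<open>The remainder theorem. Two different remainders would make a nonzero scalar divisible by
  the nonscalar \<open>P - cst a\<close>, which degrees exclude.\<close>

lemma peval_root:
  fixes P :: "('k::field, 'x) free_alg"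
  assumes P: "wdeg P > 0"
  shows "(\<exists>r. peval p P + cst a * r = cst b + P * r) \<longleftrightarrow> poly p a = b"
proof -
  have ex: "\<exists>r. peval p P - cst (poly p a) = (P - cst a) * r"
  proof -
    have "poly (p - [:poly p a:]) a = 0" by simp
    then have "[:- a, 1:] dvd p - [:poly p a:]" by (simp only: poly_eq_0_iff_dvd)
    then obtain q where "p - [:poly p a:] = [:- a, 1:] * q" by (rule dvdE)
    then have "peval (p - [:poly p a:]) P = peval [:- a, 1:] P * peval q P"
      by (simp only: peval_mult)
    also have "peval [:- a, 1:] P = P - cst a" by (simp add: peval_pCons single_uminus)
    finally show ?thesis unfolding peval_diff peval_const by blast
  qed
  have eq: "peval p P + cst a * r = cst b + P * r \<longleftrightarrow> peval p P - cst b = (P - cst a) * r" for b r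
    by (auto simp: algebra_simps)
  show ?thesis unfolding eq
  proof
    assume "poly p a = b" then show "\<exists>r. peval p P - cst b = (P - cst a) * r" using ex by blast
  next
    assume "\<exists>r. peval p P - cst b = (P - cst a) * r"
    then obtain r where r: "peval p P - cst b = (P - cst a) * r" by blast
    obtain r' where r': "peval p P - cst (poly p a) = (P - cst a) * r'" using ex by blast
    have "(P - cst a) * (r - r') = cst (poly p a) - cst b"
      unfolding right_diff_distrib r[symmetric] r'[symmetric] by simp
    then have e: "(P - cst a) * (r - r') = cst (poly p a - b)" by (simp add: single_diff)
    have nc: "\<forall>c. P - cst a \<noteq> cst c"
    proof (intro allI notI)
      fix c assume "P - cst a = cst c"
      then have "P = cst (a + c)" by (simp add: single_add algebra_simps)
      with P show False by simp
    qed
    then have pos: "wdeg (P - cst a) > 0" by (simp add: wdeg_pos_iff)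
    then have "P - cst a \<noteq> 0" by auto
    have "wdeg ((P - cst a) * (r - r')) = 0" unfolding e by simp
    then have "r - r' = 0" using top_mult(2)[OF \<open>P - cst a \<noteq> 0\<close>, of "r - r'"] pos by auto
    then have "cst (poly p a - b) = (0 :: ('k, 'x) free_alg)" using e by simp
    then show "poly p a = b" by simp
  qed
qed

lemma same_values_iff:
  fixes P Q :: "('k::field, 'x) free_alg"
  assumes inf: "infinite (UNIV :: 'k set)"
    and P: "P \<in> noninv_self_generating" and Q: "Q \<in> noninv_self_generating"
  shows "same_values x y P Q \<longleftrightarrow> (\<exists>p. x = peval p P \<and> y = peval p Q)"
proof
  assume sv: "same_values x y P Q"
  then obtain p q where p: "x = peval p P" and q: "y = peval q Q"
    using P Q by (auto simp: same_values_def nsg_iff)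
  have "poly (p - q) a = 0" for a
    using sv P Q unfolding same_values_def p q by (auto simp: peval_root nsg_iff)
  \<comment> \<open>Here the infinite field enters: a nonzero polynomial has finitely many
    roots.\<close>
  then have "p - q = 0" using poly_roots_finite[of "p - q"] inf by auto
  then show "\<exists>p. x = peval p P \<and> y = peval p Q" using p q by auto
next
  assume "\<exists>p. x = peval p P \<and> y = peval p Q"
  then show "same_values x y P Q"
    using P Q unfolding same_values_def by (auto simp: peval_root nsg_iff)
qed

definition Is_at :: "nat \<Rightarrow> nat \<Rightarrow> nat \<Rightarrow> nat \<Rightarrow> fm" where
  "Is_at x y u v =
     Conj (commute_fm x u) (Conj (commute_fm y v)
       (All 24 (Imp (scalar_fm 24 28)
          (Ex 25 (Conj (scalar_fm 25 28)
             (Conj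
               (Ex 26 (Eq (Add (Var x) (Mul (Var 24) (Var 26)))
                         (Add (Var 25) (Mul (Var u) (Var 26)))))
               (Ex 27 (Eq (Add (Var y) (Mul (Var 24) (Var 27)))
                         (Add (Var 25) (Mul (Var v) (Var 27)))))))))))"

lemma sat_Is_at:
  fixes e :: "nat \<Rightarrow> ('k::field, 'x) free_alg"
  assumes "x < 20" "y < 20" "u < 20" "v < 20"
  shows "sat e (Is_at x y u v) \<longleftrightarrow> same_values (e x) (e y) (e u) (e v)"
  unfolding same_values_def Is_at_def using assms
  by (simp add: sat_scalar_fm sat_commute_fm) blast

lemma sat_Is_fm:
  fixes e :: "nat \<Rightarrow> ('k::field, 'x) free_alg"
  shows "sat e Is_fm \<longleftrightarrow> same_values (e 0) (e 1) (e 2) (e 3)"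
  unfolding same_values_def Is_fm_def
  by (simp add: sat_scalar_fm sat_commute_fm) blast

lemma models_Is_fm: "models Is_fm [x, y, P, Q] \<longleftrightarrow> same_values x y P Q"
  for x y P Q :: "('k::field, 'x) free_alg"
  by (simp add: models_def sat_Is_fm numeral_2_eq_2 numeral_3_eq_3)

lemma centralizer_isomorphism:
  fixes P Q :: "('k::field, 'x) free_alg"
  assumes inf: "infinite (UNIV :: 'k set)"
    and P: "P \<in> noninv_self_generating" and Q: "Q \<in> noninv_self_generating"
  defines "h \<equiv> \<lambda>x. peval (coord P x) Q"
  shows "ring_iso_on (centralizer P) (centralizer Q) h"
    "h (poly_in n \<alpha> P) = poly_in n \<alpha> Q"
    "{(x, y). models Is_fm [x, y, P, Q]} = {(x, h x) | x. x \<in> centralizer P}"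
proof -
  have pos: "wdeg P > 0" "wdeg Q > 0" and
    C: "centralizer P = range (\<lambda>p. peval p P)" "centralizer Q = range (\<lambda>p. peval p Q)"
    using P Q by (auto simp: nsg_iff)
  have h: "h (peval p P) = peval p Q" for p by (simp add: h_def coord_peval pos)
  show "h (poly_in n \<alpha> P) = poly_in n \<alpha> Q" by (simp add: poly_in_eq_peval h)
  have "bij_betw h (centralizer P) (centralizer Q)"
    unfolding bij_betw_def
  proof
    show "inj_on h (centralizer P)"
      unfolding C by (rule inj_onI) (auto simp: h dest: peval_inj[OF pos(2)])
    show "h ` centralizer P = centralizer Q"
      unfolding C image_image h ..
  qed
  moreover have "h 1 = 1" using h[of 1] by simp
  moreover have "h (x + y) = h x + h y \<and> h (x * y) = h x * h y"
    if xy: "x \<in> centralizer P" "y \<in> centralizer P" for x y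
  proof -
    obtain p q where pq: "x = peval p P" "y = peval q P" using xy unfolding C by blast
    show ?thesis unfolding pq peval_add[symmetric] peval_mult[symmetric] h by (simp add: peval_add peval_mult)
  qed
  ultimately show "ring_iso_on (centralizer P) (centralizer Q) h"
    unfolding ring_iso_on_def by blast
  show "{(x, y). models Is_fm [x, y, P, Q]} = {(x, h x) | x. x \<in> centralizer P}"
    unfolding C models_Is_fm same_values_iff[OF inf P Q] using h by force
qed

section \<open>The interpretation\<close>

text \<open>A pair of \<open>x\<close> and \<open>P\<close> stands for the coordinates of
  \<open>x\<close> in \<open>K[P]\<close>. Operands from other centralizers are first transported to
  that of the first operand; 0 and 1 are fixed by every transport. The auxiliary variables 10 and 11
  are below 20, as \<open>sat_Is_at\<close> requires of its arguments.\<close>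

definition poly_interp :: interp where
  "poly_interp = \<lparr>dim = 2,
     dom_fm = Conj (commute_fm 0 1) (self_gen_at 1),
     eq_fm = Is_at 0 2 1 3,
     zero_fm = Eq (Var 0) Zero,
     one_fm = Eq (Var 0) One,
     add_fm = Ex 10 (Ex 11 (Conj (Is_at 10 2 1 3) (Conj (Is_at 11 4 1 5)
       (Eq (Add (Var 0) (Var 10)) (Var 11))))),
     mul_fm = Ex 10 (Ex 11 (Conj (Is_at 10 2 1 3) (Conj (Is_at 11 4 1 5)
       (Eq (Mul (Var 0) (Var 10)) (Var 11)))))\<rparr>"

lemma dim_poly_interp [simp]: "dim poly_interp = 2"
  by (simp add: poly_interp_def)

lemma wf_poly_interp: "wf_interp poly_interp"
  by (auto simp: wf_interp_def poly_interp_def self_gen_at_def Is_at_def unit_fm_def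
      scalar_fm_def commute_fm_def)

lemma interp_dom_poly_interp:
  "interp_dom poly_interp =
    {[x, P] | x (P :: ('k::field, 'x) free_alg). P \<in> noninv_self_generating \<and> x \<in> centralizer P}"
proof -
  have "models (dom_fm poly_interp) [x, P] \<longleftrightarrow> P \<in> noninv_self_generating \<and> x \<in> centralizer P"
    for x P :: "('k, 'x) free_alg"
    by (auto simp: models_def poly_interp_def sat_self_gen_at sat_commute_fm)
  then show ?thesis
    unfolding interp_dom_def dim_poly_interp
    by (auto simp: numeral_2_eq_2 length_Suc_conv)
qed

lemma models_eq_fm:
  "models (eq_fm poly_interp) [x, P, y, Q] \<longleftrightarrow> same_values x y P Q"
  for x P y Q :: "('k::field, 'x) free_alg"
  by (simp add: models_def poly_interp_def sat_Is_at numeral_2_eq_2 numeral_3_eq_3)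

lemma models_add_fm:
  "models (add_fm poly_interp) [x, P, y, Q, w, U] \<longleftrightarrow>
    (\<exists>y' w'. same_values y' y P Q \<and> same_values w' w P U \<and> x + y' = w')"
  for x P y Q w U :: "('k::field, 'x) free_alg"
  by (simp add: models_def poly_interp_def sat_Is_at)

lemma models_mul_fm:
  "models (mul_fm poly_interp) [x, P, y, Q, w, U] \<longleftrightarrow>
    (\<exists>y' w'. same_values y' y P Q \<and> same_values w' w P U \<and> x * y' = w')"
  for x P y Q w U :: "('k::field, 'x) free_alg"
  by (simp add: models_def poly_interp_def sat_Is_at)

lemma interprets_poly:
  fixes F :: "('k::field, 'x) free_alg list \<Rightarrow> 'k poly"
  assumes inf: "infinite (UNIV :: 'k set)" and ab: "\<exists>a b :: 'x. a \<noteq> b"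
  defines "F \<equiv> \<lambda>as. coord (as ! 1) (as ! 0)"
  shows "interprets poly_interp F"
proof -
  let ?D = "interp_dom poly_interp :: ('k, 'x) free_alg list set"
  have F: "F [peval p P, P] = p" if "P \<in> noninv_self_generating" for p P
    using that by (simp add: F_def coord_peval nsg_iff)
  have D: "\<exists>p P. P \<in> noninv_self_generating \<and> as = [peval p P, P]" if "as \<in> ?D" for as
    using that unfolding interp_dom_poly_interp by (auto simp: nsg_iff)
  have DI: "[peval p P, P] \<in> ?D" if "P \<in> noninv_self_generating" for p P
    using that unfolding interp_dom_poly_interp by (auto simp: nsg_iff)
  have inj: "peval p P = peval q P \<longleftrightarrow> p = q" if "P \<in> noninv_self_generating" for p q and P :: "('k, 'x) free_alg"
    using that peval_inj by (auto simp: nsg_iff)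
  \<comment> \<open>Transport has exactly one result, so the witnesses in the formulas for sum and
    product are determined.\<close>
  have same: "same_values x (peval q Q) P Q \<longleftrightarrow> x = peval q P"
    if "P \<in> noninv_self_generating" "Q \<in> noninv_self_generating" for x q and P Q :: "('k, 'x) free_alg"
    using that by (auto simp: same_values_iff[OF inf] inj)
  have "F ` ?D = UNIV"
  proof -
    obtain P :: "('k, 'x) free_alg" where P: "P \<in> noninv_self_generating" using ex_nsg[OF ab] by blast
    have "p \<in> F ` ?D" for p using F[OF P, of p] DI[OF P, of p] by (intro image_eqI) auto
    then show ?thesis by blast
  qed
  moreover have "models (eq_fm poly_interp) (a @ b) \<longleftrightarrow> F a = F b" if "a \<in> ?D" "b \<in> ?D" for a b
  proof -
    from D[OF that(1)] D[OF that(2)] obtain p P q Q where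
      a: "P \<in> noninv_self_generating" "a = [peval p P, P]" and
      b: "Q \<in> noninv_self_generating" "b = [peval q Q, Q]" by blast
    show ?thesis by (simp add: a b F models_eq_fm same inj)
  qed
  moreover have "models (zero_fm poly_interp) a \<longleftrightarrow> F a = 0"
    "models (one_fm poly_interp) a \<longleftrightarrow> F a = 1" if "a \<in> ?D" for a
  proof -
    from D[OF that] obtain p P where a: "P \<in> noninv_self_generating" "a = [peval p P, P]" by blast
    show "models (zero_fm poly_interp) a \<longleftrightarrow> F a = 0"
      using inj[OF a(1), of p 0] by (simp add: a F models_def poly_interp_def)
    show "models (one_fm poly_interp) a \<longleftrightarrow> F a = 1"
      using inj[OF a(1), of p 1] by (simp add: a F models_def poly_interp_def)
  qed
  moreover have "(models (add_fm poly_interp) (a @ b @ c) \<longleftrightarrow> F a + F b = F c) \<and>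
      (models (mul_fm poly_interp) (a @ b @ c) \<longleftrightarrow> F a * F b = F c)"
    if "a \<in> ?D" "b \<in> ?D" "c \<in> ?D" for a b c
  proof -
    from D[OF that(1)] D[OF that(2)] D[OF that(3)] obtain p P q Q r U where
      a: "P \<in> noninv_self_generating" "a = [peval p P, P]" and
      b: "Q \<in> noninv_self_generating" "b = [peval q Q, Q]" and
      c: "U \<in> noninv_self_generating" "c = [peval r U, U]" by blast
    show ?thesis
      by (simp add: a b c F models_add_fm models_mul_fm same peval_add[symmetric] peval_mult[symmetric] inj)
  qed
  ultimately show ?thesis
    unfolding interprets_def using wf_poly_interp by blast
qed

theorem theorem6p10:
  assumes "infinite (UNIV :: 'k::field set)"
    and "\<exists>a b :: 'x. a \<noteq> b"
  shows
    "defined_by self_gen_fm 1 {[P] | P :: ('k, 'x) free_alg. P \<in> noninv_self_generating}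
     \<and>
     (free_vars Is_fm \<subseteq> {..<4} \<and>
      (\<forall>P \<in> noninv_self_generating :: ('k, 'x) free_alg set. \<forall>Q \<in> noninv_self_generating.
        \<exists>h :: ('k, 'x) free_alg \<Rightarrow> ('k, 'x) free_alg.
          ring_iso_on (centralizer P) (centralizer Q) h \<and>
          (\<forall>n \<alpha>. h (poly_in n \<alpha> P) = poly_in n \<alpha> Q) \<and>
          {(x, y). models Is_fm [x, y, P, Q]} = {(x, h x) | x. x \<in> centralizer P}))
     \<and>
     ((proper_centralizers :: ('k, 'x) free_alg set set) = centralizer ` noninv_self_generating \<and>
      (\<exists>\<Gamma> (F :: ('k, 'x) free_alg list \<Rightarrow> 'k poly).
        interprets \<Gamma> F \<and>
        dim \<Gamma> = 2 \<and>
        interp_dom \<Gamma> = {[x, P] | x (P :: ('k, 'x) free_alg). P \<in> noninv_self_generating \<and> x \<in> centralizer P} \<and>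
        (\<forall>P \<in> noninv_self_generating :: ('k, 'x) free_alg set. \<forall>Q \<in> noninv_self_generating.
           \<forall>x \<in> centralizer P. \<forall>y \<in> centralizer Q.
             models (eq_fm \<Gamma>) [x, P, y, Q] \<longleftrightarrow> models Is_fm [x, y, P, Q]) \<and>
        (\<forall>P \<in> noninv_self_generating. \<forall>n \<alpha>.
           F [poly_in n \<alpha> P, P] = (\<Sum>i\<le>n. monom (\<alpha> i) i))))"
proof (intro conjI)
  show "defined_by self_gen_fm 1 {[P] | P :: ('k, 'x) free_alg. P \<in> noninv_self_generating}"
    by (rule self_gen_fm_defines)
  show "free_vars Is_fm \<subseteq> {..<4}"
    by (auto simp: Is_fm_def scalar_fm_def unit_fm_def commute_fm_def)
  show "\<forall>P \<in> noninv_self_generating :: ('k, 'x) free_alg set. \<forall>Q \<in> noninv_self_generating.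
        \<exists>h :: ('k, 'x) free_alg \<Rightarrow> ('k, 'x) free_alg.
          ring_iso_on (centralizer P) (centralizer Q) h \<and>
          (\<forall>n \<alpha>. h (poly_in n \<alpha> P) = poly_in n \<alpha> Q) \<and>
          {(x, y). models Is_fm [x, y, P, Q]} = {(x, h x) | x. x \<in> centralizer P}"
    using centralizer_isomorphism[OF assms(1)] by (intro ballI exI conjI allI) blast+
  show "(proper_centralizers :: ('k, 'x) free_alg set set) = centralizer ` noninv_self_generating"
    by (rule proper_centralizers_eq[OF assms(2)])
  let ?F = "\<lambda>as :: ('k, 'x) free_alg list. coord (as ! 1) (as ! 0)"
  have "\<forall>P \<in> noninv_self_generating :: ('k, 'x) free_alg set. \<forall>Q \<in> noninv_self_generating.
           \<forall>x \<in> centralizer P. \<forall>y \<in> centralizer Q.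
             models (eq_fm poly_interp) [x, P, y, Q] \<longleftrightarrow> models Is_fm [x, y, P, Q]"
    by (simp add: models_eq_fm models_Is_fm)
  moreover have "\<forall>P \<in> noninv_self_generating. \<forall>n \<alpha>.
           ?F [poly_in n \<alpha> P, P] = (\<Sum>i\<le>n. monom (\<alpha> i) i)"
    by (simp add: poly_in_eq_peval coord_peval nsg_iff)
  ultimately show "\<exists>\<Gamma> (F :: ('k, 'x) free_alg list \<Rightarrow> 'k poly).
        interprets \<Gamma> F \<and>
        dim \<Gamma> = 2 \<and>
        interp_dom \<Gamma> = {[x, P] | x (P :: ('k, 'x) free_alg). P \<in> noninv_self_generating \<and> x \<in> centralizer P} \<and>
        (\<forall>P \<in> noninv_self_generating :: ('k, 'x) free_alg set. \<forall>Q \<in> noninv_self_generating.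
           \<forall>x \<in> centralizer P. \<forall>y \<in> centralizer Q.
             models (eq_fm \<Gamma>) [x, P, y, Q] \<longleftrightarrow> models Is_fm [x, y, P, Q]) \<and>
        (\<forall>P \<in> noninv_self_generating. \<forall>n \<alpha>.
           F [poly_in n \<alpha> P, P] = (\<Sum>i\<le>n. monom (\<alpha> i) i))"
    using interprets_poly[OF assms] dim_poly_interp interp_dom_poly_interp by blast
qed

end
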